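(* Let $(X,d,\mu)$ be a quasi-metric-measure space. Let $\nu$ be a measure (on the same $\sigma$-algebra as $\mu$) such that $\nu\le C\mu$ for some constant $C\in(0,\infty)$. If $\mu$ is $\nu$-integrable, i.e., if there exists a quasi-metric $\varrho$ on $X$ which is equivalent to $d$ and such that for each fixed $r\in(0,\infty)$ the mapping $x\mapsto\mu(B_\varrho(x,r))$ is well defined, measurable, and $$\int_X\frac{1}{\mu(B_\varrho(x,r))}\,d\nu(x)<\infty,$$ then, for any $\alpha,p\in(0,\infty)$ and $q\in(0,\infty]$, the embeddings $$M^\alpha_{p,q}(X,d,\mu)\hookrightarrow L^p(X,\nu)\quad\text{and}\quad N^\alpha_{p,q}(X,d,\mu)\hookrightarrow L^p(X,\nu)$$ are compact. In particular, these embeddings are compact if $(X,d)$ is totally bounded.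
   Context: A quasi-metric space $(X,d)$ is a set $X$ with at least two elements and a function $d:X\times X\to[0,\infty)$ for which there are constants $C_0,C_1\in(0,\infty)$ such that for all $x,y,z\in X$: $d(x,y)=0$ iff $x=y$; $d(y,x)\le C_0 d(x,y)$; $d(x,y)\le C_1\max\{d(x,z),d(z,y)\}$ (symmetry is not required). Balls are $B_d(x,r):=\{y\in X:d(x,y)<r\}$. The topology $\tau_d$ consists of all $\mathcal O\subseteq X$ such that for each $x\in\mathcal O$ there is $r>0$ with $B_d(x,r)\subseteq\mathcal O$. Quasi-metrics $d,\varrho$ are equivalent if $\kappa^{-1}\varrho\le d\le\kappa\varrho$ on $X\times X$ for some constant $\kappa>0$. A quasi-metric-measure space $(X,d,\mu)$ is a quasi-metric space with a nonnegative measure $\mu$ on a $\sigma$-algebra containing the Borel sets of $\tau_d$, such that all $d$-balls are measurable and $\mu(B_d(x,r))\in(0,\infty)$ for all $x\in X$, $r\in(0,\infty)$. "Well defined" above means that the $\varrho$-balls are measurable. $(X,d)$ is totally bounded if for every $\varepsilon>0$ it is covered by finitely many balls $B_d(x_i,\varepsilon)$. Fractional gradients: for $\alpha\in(0,\infty)$ and measurable $u:X\to\mathbb R$, $\mathbb D^\alpha_d(u)$ is the set of sequences $\vec g=\{g_k\}_{k\in\mathbb Z}$ of nonnegative measurable functions on $X$ for which there is a measurable $E$ with $\mu(E)=0$ and $|u(x)-u(y)|\le[d(x,y)]^\alpha(g_k(x)+g_k(y))$ for all $k\in\mathbb Z$ and $x,y\in X\setminus E$ with $2^{-k-1}\le d(x,y)<2^{-k}$.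 The Hajłasz–Triebel–Lizorkin space $M^\alpha_{p,q}(X,d,\mu)$ is the set of $u\in L^p(X,\mu)$ with finite (quasi-)norm $\|u\|_{L^p(X,\mu)}+\inf_{\vec g\in\mathbb D^\alpha_d(u)}\big\|\,\|\{g_k\}_k\|_{\ell^q(\mathbb Z)}\big\|_{L^p(X,\mu)}$; the Hajłasz–Besov space $N^\alpha_{p,q}(X,d,\mu)$ is the set of $u\in L^p(X,\mu)$ with finite (quasi-)norm $\|u\|_{L^p(X,\mu)}+\inf_{\vec g\in\mathbb D^\alpha_d(u)}\big\|\{\|g_k\|_{L^p(X,\mu)}\}_k\big\|_{\ell^q(\mathbb Z)}$. An embedding is compact if the natural map (identity on functions) is well defined and maps bounded sets to totally bounded sets. *)

theory Defs
  imports "HOL-Analysis.Analysis"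
begin

section \<open>Quasi-metric spaces\<close>

definition quasi_metric_on :: "'a set \<Rightarrow> ('a \<Rightarrow> 'a \<Rightarrow> real) \<Rightarrow> bool" where
  "quasi_metric_on X d \<longleftrightarrow>
     (\<exists>x\<in>X. \<exists>y\<in>X. x \<noteq> y) \<and>
     (\<forall>x\<in>X. \<forall>y\<in>X. 0 \<le> d x y) \<and>
     (\<forall>x\<in>X. \<forall>y\<in>X. d x y = 0 \<longleftrightarrow> x = y) \<and>
     (\<exists>C0>0. \<forall>x\<in>X. \<forall>y\<in>X. d y x \<le> C0 * d x y) \<and>
     (\<exists>C1>0. \<forall>x\<in>X. \<forall>y\<in>X. \<forall>z\<in>X. d x y \<le> C1 * max (d x z) (d z y))"

definition qball :: "'a set \<Rightarrow> ('a \<Rightarrow> 'a \<Rightarrow> real) \<Rightarrow> 'a \<Rightarrow> real \<Rightarrow> 'a set" where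
  "qball X d x r = {y \<in> X. d x y < r}"

definition qopen_sets :: "'a set \<Rightarrow> ('a \<Rightarrow> 'a \<Rightarrow> real) \<Rightarrow> 'a set set" where
  "qopen_sets X d = {U. U \<subseteq> X \<and> (\<forall>x\<in>U. \<exists>r>0. qball X d x r \<subseteq> U)}"

definition equivalent_quasi_metrics ::
    "'a set \<Rightarrow> ('a \<Rightarrow> 'a \<Rightarrow> real) \<Rightarrow> ('a \<Rightarrow> 'a \<Rightarrow> real) \<Rightarrow> bool" where
  "equivalent_quasi_metrics X d \<rho> \<longleftrightarrow>
     (\<exists>\<kappa>>0. \<forall>x\<in>X. \<forall>y\<in>X. inverse \<kappa> * \<rho> x y \<le> d x y \<and> d x y \<le> \<kappa> * \<rho> x y)"

definition totally_bounded_quasi_metric :: "'a set \<Rightarrow> ('a \<Rightarrow> 'a \<Rightarrow> real) \<Rightarrow> bool" where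
  "totally_bounded_quasi_metric X d \<longleftrightarrow>
     (\<forall>\<epsilon>>0. \<exists>F. finite F \<and> F \<subseteq> X \<and> X \<subseteq> (\<Union>x\<in>F. qball X d x \<epsilon>))"

text \<open>
  The underlying set of a quasi-metric-measure space is the space of the measure; the values of
  \<open>d\<close> outside it are irrelevant.
\<close>

definition quasi_metric_measure_space :: "('a \<Rightarrow> 'a \<Rightarrow> real) \<Rightarrow> 'a measure \<Rightarrow> bool" where
  "quasi_metric_measure_space d M \<longleftrightarrow>
     quasi_metric_on (space M) d \<and>
     sigma_sets (space M) (qopen_sets (space M) d) \<subseteq> sets M \<and>
     (\<forall>x\<in>space M. \<forall>r>0. qball (space M) d x r \<in> sets M \<and>
        0 < emeasure M (qball (space M) d x r) \<and> emeasure M (qball (space M) d x r) < \<infinity>)"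

definition measure_integrable_wrt ::
    "('a \<Rightarrow> 'a \<Rightarrow> real) \<Rightarrow> 'a measure \<Rightarrow> 'a measure \<Rightarrow> bool" where
  "measure_integrable_wrt d M N \<longleftrightarrow>
     (\<exists>\<rho>. quasi_metric_on (space M) \<rho> \<and> equivalent_quasi_metrics (space M) d \<rho> \<and>
        (\<forall>r>0.
           (\<forall>x\<in>space M. qball (space M) \<rho> x r \<in> sets M) \<and>
           (\<lambda>x. emeasure M (qball (space M) \<rho> x r)) \<in> borel_measurable M \<and>
           (\<integral>\<^sup>+x. 1 / emeasure M (qball (space M) \<rho> x r) \<partial>N) < \<infinity>))"


section \<open>Lebesgue and sequence spaces\<close>

text \<open>Only used with exponent \<open>r > 0\<close>, where \<open>\<infinity>\<^sup>r = \<infinity>\<close>.\<close>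

definition ennpowr :: "ennreal \<Rightarrow> real \<Rightarrow> ennreal" where
  "ennpowr a r = (if a = \<infinity> then \<infinity> else ennreal (enn2real a powr r))"

definition Lp_enorm :: "real \<Rightarrow> 'a measure \<Rightarrow> ('a \<Rightarrow> ennreal) \<Rightarrow> ennreal" where
  "Lp_enorm p M f = ennpowr (\<integral>\<^sup>+x. ennpowr (f x) p \<partial>M) (1 / p)"

definition lq_enorm :: "ennreal \<Rightarrow> (int \<Rightarrow> ennreal) \<Rightarrow> ennreal" where
  "lq_enorm q a =
     (if q = \<infinity> then (SUP k. a k)
      else ennpowr (\<integral>\<^sup>+k. ennpowr (a k) (enn2real q) \<partial>count_space UNIV) (1 / enn2real q))"

text \<open>
  Function spaces consist of functions rather than of classes modulo equality almost everywhere, so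
  that the (quasi-)norms are (quasi-)seminorms, with value \<open>\<infinity>\<close> allowed.
\<close>

definition Lp_norm :: "real \<Rightarrow> 'a measure \<Rightarrow> ('a \<Rightarrow> real) \<Rightarrow> ennreal" where
  "Lp_norm p M u = Lp_enorm p M (\<lambda>x. ennreal \<bar>u x\<bar>)"

definition Lp_space :: "real \<Rightarrow> 'a measure \<Rightarrow> ('a \<Rightarrow> real) set" where
  "Lp_space p M = {u \<in> borel_measurable M. Lp_norm p M u < \<infinity>}"


section \<open>Hajlasz--Triebel--Lizorkin and Hajlasz--Besov spaces\<close>

definition fractional_gradients ::
    "real \<Rightarrow> ('a \<Rightarrow> 'a \<Rightarrow> real) \<Rightarrow> 'a measure \<Rightarrow> ('a \<Rightarrow> real) \<Rightarrow> (int \<Rightarrow> 'a \<Rightarrow> real) set" where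
  "fractional_gradients \<alpha> d M u =
     {g. (\<forall>k. g k \<in> borel_measurable M \<and> (\<forall>x\<in>space M. 0 \<le> g k x)) \<and>
         (\<exists>E\<in>null_sets M. \<forall>k. \<forall>x\<in>space M - E. \<forall>y\<in>space M - E.
            2 powi (- k - 1) \<le> d x y \<and> d x y < 2 powi (- k) \<longrightarrow>
            \<bar>u x - u y\<bar> \<le> d x y powr \<alpha> * (g k x + g k y))}"

definition HTL_norm ::
    "real \<Rightarrow> real \<Rightarrow> ennreal \<Rightarrow> ('a \<Rightarrow> 'a \<Rightarrow> real) \<Rightarrow> 'a measure \<Rightarrow> ('a \<Rightarrow> real) \<Rightarrow> ennreal" where
  "HTL_norm \<alpha> p q d M u = Lp_norm p M u +
     (INF g\<in>fractional_gradients \<alpha> d M u. Lp_enorm p M (\<lambda>x. lq_enorm q (\<lambda>k. ennreal (g k x))))"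

definition HTL_space ::
    "real \<Rightarrow> real \<Rightarrow> ennreal \<Rightarrow> ('a \<Rightarrow> 'a \<Rightarrow> real) \<Rightarrow> 'a measure \<Rightarrow> ('a \<Rightarrow> real) set" where
  "HTL_space \<alpha> p q d M = {u \<in> Lp_space p M. HTL_norm \<alpha> p q d M u < \<infinity>}"

definition HB_norm ::
    "real \<Rightarrow> real \<Rightarrow> ennreal \<Rightarrow> ('a \<Rightarrow> 'a \<Rightarrow> real) \<Rightarrow> 'a measure \<Rightarrow> ('a \<Rightarrow> real) \<Rightarrow> ennreal" where
  "HB_norm \<alpha> p q d M u = Lp_norm p M u +
     (INF g\<in>fractional_gradients \<alpha> d M u. lq_enorm q (\<lambda>k. Lp_norm p M (g k)))"

definition HB_space ::
    "real \<Rightarrow> real \<Rightarrow> ennreal \<Rightarrow> ('a \<Rightarrow> 'a \<Rightarrow> real) \<Rightarrow> 'a measure \<Rightarrow> ('a \<Rightarrow> real) set" where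
  "HB_space \<alpha> p q d M = {u \<in> Lp_space p M. HB_norm \<alpha> p q d M u < \<infinity>}"


section \<open>Compact embeddings\<close>

definition totally_bounded_in_Lp :: "real \<Rightarrow> 'a measure \<Rightarrow> ('a \<Rightarrow> real) set \<Rightarrow> bool" where
  "totally_bounded_in_Lp p N B \<longleftrightarrow>
     (\<forall>\<epsilon>>0. \<exists>F. finite F \<and> F \<subseteq> Lp_space p N \<and>
        B \<subseteq> (\<Union>f\<in>F. {u \<in> Lp_space p N. Lp_norm p N (\<lambda>x. u x - f x) < ennreal \<epsilon>}))"

text \<open>
  \<open>S\<close> is a space of functions on \<open>M\<close>, quasi-normed by \<open>nrm\<close>. The first two conjuncts say that the
  identity induces a well-defined map from \<open>S\<close> modulo equality \<open>M\<close>-almost everywhere to \<open>L\<^sup>p(N)\<close>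
  modulo equality \<open>N\<close>-almost everywhere.
\<close>

definition compact_embedding_Lp ::
    "'a measure \<Rightarrow> ('a \<Rightarrow> real) set \<Rightarrow> (('a \<Rightarrow> real) \<Rightarrow> ennreal) \<Rightarrow> real \<Rightarrow> 'a measure \<Rightarrow> bool" where
  "compact_embedding_Lp M S nrm p N \<longleftrightarrow>
     S \<subseteq> Lp_space p N \<and>
     (\<forall>u\<in>S. \<forall>v\<in>S. (AE x in M. u x = v x) \<longrightarrow> (AE x in N. u x = v x)) \<and>
     (\<forall>B\<subseteq>S. (\<exists>R::real. \<forall>u\<in>B. nrm u \<le> ennreal R) \<longrightarrow> totally_bounded_in_Lp p N B)"

end

theory Submission
  imports Defs
begin

text \<open>
  A bound on either norm gives every function \<open>u\<close> of the family a fractional gradient whose members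
  \<open>g\<^sub>k\<close> all have \<open>L\<^sup>p\<close>-norm below one constant, because every \<open>\<ell>\<^sup>q\<close>-norm
  dominates the single members of a sequence. Summing \<open>2\<^sup>p 2\<^bsup>-k\<alpha>p\<^esup> g\<^sub>k\<^sup>p\<close> over the scales
  \<open>k \<ge> K\<close> produces a single function \<open>h\<close> with
  \<open>|u(x) - u(y)|\<^sup>p \<le> h(x) + h(y)\<close> whenever \<open>d(x,y) < 2\<^bsup>-K\<^esup>\<close>, off a null set. Its
  \<open>\<mu>\<close>-integral is at most the tail of a convergent geometric series and tends to \<open>0\<close> as \<open>K \<rightarrow> \<infinity>\<close>, uniformly in
  the family (\<open>uniform_oscillation_majorants\<close>). As \<open>x\<close> and \<open>y\<close> are separated on the right-hand
  side, every later estimate averages over one variable only, so that the measures of different balls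
  never have to be compared.

  Suppose that the space splits, for a given small \<open>r\<close>, into finitely many disjoint pieces of
  \<open>d\<close>-diameter below \<open>r\<close> and finite measure, and a tail \<open>A\<close> on which \<open>w\<close>, an upper bound for the
  reciprocal measure of suitable neighbourhoods inside the \<open>r\<close>-balls, has a small \<open>\<nu>\<close>-integral.
  On a piece \<open>P\<close>, choose a point \<open>y\<close> at which \<open>h\<close> does not exceed its average over \<open>P\<close>; then
  \<open>\<integral>\<^sub>P |u - u(y)|\<^sup>p d\<mu> \<le> 2 \<integral>\<^sub>P h d\<mu>\<close>, so that \<open>u\<close> is nearly constant there
  (\<open>constant_approximation_on_piece\<close>). On the tail, compare \<open>u(x)\<close> with \<open>u(y)\<close> for a point \<open>y\<close> of
  the neighbourhood of \<open>x\<close> at which \<open>h + |u|\<^sup>p\<close> does not exceed its average; then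
  \<open>|u(x)|\<^sup>p \<le> 2\<^sup>p (h(x) + w(x) \<integral>(h + |u|\<^sup>p) d\<mu>)\<close>, and \<open>u\<close> has little mass on \<open>A\<close>
  (\<open>tail_integral_le\<close>). The order of choices is \<open>r\<close> first, to make \<open>\<integral> h d\<mu>\<close> small, then \<open>A\<close>. Hence the
  family is uniformly close in \<open>L\<^sup>p(\<nu>)\<close> to step functions on finitely many fixed pieces, with bounded
  coefficients, and these are approximated by the finitely many step functions with coefficients on
  a grid (\<open>totally_bounded_in_Lp_if_uniform_majorants\<close>).

  It remains to find such splittings. In a totally bounded space finitely many small balls leave
  no tail. If \<open>\<mu>\<close> is \<open>\<nu>\<close>-integrable, the tail lies in the set of points far away from a base
  point or with a ball \<open>B\<^sub>\<rho>(x,s)\<close> of small measure; \<open>w(x) = 1/\<mu>(B\<^sub>\<rho>(x,s))\<close> is \<open>\<nu>\<close>-integrable, so its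
  integral over this set is small. The remaining points lie in a bounded region and have balls of
  measure bounded below, so that only finitely many of these balls can be disjoint, and enlarging a
  maximal disjoint family covers the rest (\<open>small_pieces_if_measure_integrable\<close>).
\<close>


section \<open>Powers and the quasi-norms\<close>

text \<open>This replaces the triangle inequality, uniformly for \<open>p < 1\<close> and \<open>p \<ge> 1\<close>.\<close>
lemma powr_sum_le:
  fixes a b p :: real
  assumes "0 < p"
  shows "\<bar>a + b\<bar> powr p \<le> 2 powr p * (\<bar>a\<bar> powr p + \<bar>b\<bar> powr p)"
proof -
  have "\<bar>a + b\<bar> powr p \<le> (2 * max \<bar>a\<bar> \<bar>b\<bar>) powr p"
    using assms by (intro powr_mono2) auto
  also have "\<dots> = 2 powr p * (max \<bar>a\<bar> \<bar>b\<bar>) powr p"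
    by (simp add: powr_mult)
  also have "\<dots> \<le> 2 powr p * (\<bar>a\<bar> powr p + \<bar>b\<bar> powr p)"
    by (intro mult_left_mono) (auto simp: max_def)
  finally show ?thesis .
qed

lemma ennreal_powr_sum_le:
  fixes a b p :: real
  assumes "0 < p"
  shows "ennreal (\<bar>a + b\<bar> powr p)
    \<le> ennreal (2 powr p) * (ennreal (\<bar>a\<bar> powr p) + ennreal (\<bar>b\<bar> powr p))"
  using powr_sum_le[OF assms, of a b]
  by (simp add: ennreal_mult[symmetric] ennreal_plus[symmetric] del: ennreal_plus)

lemma ennpowr_ennreal: "0 \<le> a \<Longrightarrow> ennpowr (ennreal a) r = ennreal (a powr r)"
  by (simp add: ennpowr_def)

lemma ennpowr_mono: "a \<le> b \<Longrightarrow> 0 < r \<Longrightarrow> ennpowr a r \<le> ennpowr b r"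
  by (auto simp: ennpowr_def top_unique less_top intro!: ennreal_leI powr_mono2 enn2real_mono)

lemma ennpowr_ennpowr_inverse: "0 < r \<Longrightarrow> ennpowr (ennpowr a r) (1 / r) = a"
  by (auto simp: ennpowr_def powr_powr less_top)

lemma ennpowr_inverse_ennpowr: "0 < r \<Longrightarrow> ennpowr (ennpowr a (1 / r)) r = a"
  by (auto simp: ennpowr_def powr_powr less_top)

lemma Lp_norm_eq:
  "Lp_norm p M u = ennpowr (\<integral>\<^sup>+x. ennreal (\<bar>u x\<bar> powr p) \<partial>M) (1 / p)"
  by (simp add: Lp_norm_def Lp_enorm_def ennpowr_ennreal)

lemma Lp_enorm_mono:
  assumes "\<And>x. x \<in> space M \<Longrightarrow> f x \<le> g x" "0 < p"
  shows "Lp_enorm p M f \<le> Lp_enorm p M g"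
  unfolding Lp_enorm_def using assms
  by (intro ennpowr_mono nn_integral_mono) auto

lemma integral_powr_le_if_Lp_norm_le:
  assumes "0 < p" "0 \<le> R" "Lp_norm p M u \<le> ennreal R"
  shows "(\<integral>\<^sup>+x. ennreal (\<bar>u x\<bar> powr p) \<partial>M) \<le> ennreal (R powr p)"
  using ennpowr_mono[OF assms(3) assms(1)] assms(1,2)
  by (simp add: Lp_norm_eq ennpowr_inverse_ennpowr ennpowr_ennreal)

lemma Lp_norm_less_if_integral_powr_less:
  assumes "0 < p" "0 < \<epsilon>" "(\<integral>\<^sup>+x. ennreal (\<bar>u x\<bar> powr p) \<partial>M) < ennreal (\<epsilon> powr p)"
  shows "Lp_norm p M u < ennreal \<epsilon>"
proof (rule ccontr)
  assume "\<not> ?thesis"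
  hence "ennpowr (ennreal \<epsilon>) p \<le> ennpowr (Lp_norm p M u) p"
    using assms by (intro ennpowr_mono) auto
  with assms show False
    by (simp add: Lp_norm_eq ennpowr_inverse_ennpowr ennpowr_ennreal)
qed

lemma Lp_space_iff:
  assumes "0 < p"
  shows "u \<in> Lp_space p M \<longleftrightarrow>
    u \<in> borel_measurable M \<and> (\<integral>\<^sup>+x. ennreal (\<bar>u x\<bar> powr p) \<partial>M) < \<infinity>"
  by (auto simp: Lp_space_def Lp_norm_eq ennpowr_def less_top)

text \<open>
  This reduces all exponents \<open>q\<close> to the case of weakest information, a bound on the gradient at each
  scale separately.
\<close>
lemma component_le_lq_enorm:
  assumes "0 < q"
  shows "a k \<le> lq_enorm q a"
proof (cases "q = \<infinity>")
  case True
  thus ?thesis by (auto simp: lq_enorm_def intro: SUP_upper)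
next
  case False
  hence q: "0 < enn2real q"
    using assms by (simp add: enn2real_positive_iff less_top)
  have "a k = ennpowr (ennpowr (a k) (enn2real q)) (1 / enn2real q)"
    using q by (simp add: ennpowr_ennpowr_inverse)
  also have "\<dots> \<le> lq_enorm q a"
    using False q by (auto simp: lq_enorm_def intro!: ennpowr_mono nn_integral_ge_point)
  finally show ?thesis .
qed

section \<open>Dominated measures and averages\<close>

lemma nn_integral_le_of_measure_le:
  assumes "sets N = sets M" and "\<forall>A\<in>sets M. emeasure N A \<le> ennreal C * emeasure M A"
    and "f \<in> borel_measurable M"
  shows "(\<integral>\<^sup>+x. f x \<partial>N) \<le> ennreal C * (\<integral>\<^sup>+x. f x \<partial>M)"
proof -
  have "N \<le> scale_measure (ennreal C) M"
    using assms by (subst le_measure) auto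
  hence "(\<integral>\<^sup>+x. f x \<partial>N) \<le> (\<integral>\<^sup>+x. f x \<partial>scale_measure (ennreal C) M)"
    using assms(1) by (intro nn_integral_mono_measure) auto
  thus ?thesis using assms(3) by (simp add: nn_integral_scale_measure)
qed

lemma AE_of_measure_le:
  assumes "sets N = sets M" and "\<forall>A\<in>sets M. emeasure N A \<le> ennreal C * emeasure M A"
    and "AE x in M. Q x"
  shows "AE x in N. Q x"
proof -
  from assms(3) obtain E where E: "E \<in> sets M" "emeasure M E = 0" "{x\<in>space M. \<not> Q x} \<subseteq> E"
    by (rule AE_E)
  hence "E \<in> null_sets N" using assms(1,2) by (force simp: null_sets_def)
  moreover have "{x\<in>space N. \<not> Q x} \<subseteq> E"
    using E sets_eq_imp_space_eq[OF assms(1)] by simp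
  ultimately show ?thesis by (rule AE_I')
qed

text \<open>
  Averaging arguments only need one good point: if \<open>f\<close> exceeded its average at almost every point of
  \<open>D\<close>, its integral over \<open>D\<close> would exceed itself. The null set \<open>E\<close> lets the point avoid the places
  where the pointwise gradient inequality fails.
\<close>
lemma point_below_average:
  assumes D: "D \<in> sets M" "0 < emeasure M D" "emeasure M D < \<infinity>"
    and E: "E \<in> null_sets M" and f: "f \<in> borel_measurable M"
  shows "\<exists>y\<in>D - E. f y * emeasure M D \<le> (\<integral>\<^sup>+x\<in>D. f x \<partial>M)"
proof (rule ccontr)
  define I where "I = (\<integral>\<^sup>+x\<in>D. f x \<partial>M)"
  assume "\<not> ?thesis"
  hence *: "I < f y * emeasure M D" if "y \<in> D - E" for y
    using that by (auto simp: I_def not_le)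
  have "emeasure M (D - E) = emeasure M D"
    using D E by (intro emeasure_Diff_null_set) auto
  hence "D - E \<noteq> {}" using D by (metis emeasure_empty less_irrefl)
  hence I: "I \<noteq> \<infinity>" using * by force
  have AE: "AE x in M. x \<notin> E" using E by (rule AE_not_in)
  \<comment> \<open>Both integrals equal \<open>I * emeasure M D\<close>; multiplying through avoids division in \<open>ennreal\<close>.\<close>
  have "(\<integral>\<^sup>+x. I * indicator D x \<partial>M) < (\<integral>\<^sup>+x. f x * emeasure M D * indicator D x \<partial>M)"
  proof (rule nn_integral_less)
    show "(\<integral>\<^sup>+x. I * indicator D x \<partial>M) \<noteq> \<infinity>"
      using D I by (simp add: nn_integral_cmult_indicator ennreal_mult_eq_top_iff)
    show "AE x in M. I * indicator D x \<le> f x * emeasure M D * indicator D x"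
      using AE by eventually_elim (use * in \<open>auto simp: indicator_def less_imp_le\<close>)
    show "\<not> (AE x in M. f x * emeasure M D * indicator D x \<le> I * indicator D x)"
    proof
      assume "AE x in M. f x * emeasure M D * indicator D x \<le> I * indicator D x"
      hence "AE x in M. x \<notin> D"
        using AE by eventually_elim (use * in \<open>force simp: indicator_def not_le\<close>)
      hence "emeasure M D = 0" using D AE_iff_null_sets[OF D(1)] by auto
      with D show False by simp
    qed
  qed (use D f in auto)
  moreover have "(\<integral>\<^sup>+x. f x * emeasure M D * indicator D x \<partial>M) = I * emeasure M D"
    unfolding I_def using D f
    by (subst nn_integral_multc[symmetric]) (auto simp: ac_simps)
  ultimately show False using D by (simp add: nn_integral_cmult_indicator)
qed


section \<open>Oscillation at small scales\<close>

text \<open>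
  The values of \<open>h\<close> are extended reals because it arises as a sum over infinitely many scales, which
  may diverge at individual points.
\<close>
definition oscillation_majorant ::
    "real \<Rightarrow> ('a \<Rightarrow> 'a \<Rightarrow> real) \<Rightarrow> 'a measure \<Rightarrow> real \<Rightarrow> ('a \<Rightarrow> real) \<Rightarrow> ('a \<Rightarrow> ennreal) \<Rightarrow> bool" where
  "oscillation_majorant p d M r u h \<longleftrightarrow> h \<in> borel_measurable M \<and>
     (\<exists>E\<in>null_sets M. \<forall>x\<in>space M - E. \<forall>y\<in>space M - E. d x y < r \<longrightarrow>
        ennreal (\<bar>u x - u y\<bar> powr p) \<le> h x + h y)"

text \<open>
  Below \<open>2\<^bsup>-K\<^esup>\<close>, only the scales \<open>k = K + i\<close> of a fractional gradient occur.
\<close>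
lemma dyadic_scale:
  fixes t :: real
  assumes "0 < t" "t < (1 / 2) ^ K"
  shows "\<exists>i. (1 / 2) ^ Suc (K + i) \<le> t \<and> t < (1 / 2) ^ (K + i)"
proof -
  define n where "n = (LEAST n. (1 / 2) ^ n \<le> t)"
  have "\<exists>n. (1 / 2) ^ n < t" using assms(1) by (intro real_arch_pow_inv) auto
  hence n: "(1 / 2) ^ n \<le> t" unfolding n_def by (metis LeastI less_imp_le)
  have "K < n"
  proof (rule ccontr)
    assume "\<not> K < n"
    hence "(1 / 2 :: real) ^ K \<le> (1 / 2) ^ n" by (intro power_decreasing) auto
    with n assms show False by simp
  qed
  then obtain i where i: "n = Suc (K + i)" using less_imp_Suc_add by blast
  have "\<not> (1 / 2) ^ (K + i) \<le> t"
    by (rule not_less_Least) (use i in \<open>simp add: n_def\<close>)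
  with n i show ?thesis by (intro exI[of _ i]) auto
qed

text \<open>
  At distance about \<open>2\<^bsup>-k\<^esup>\<close> the gradient inequality, raised to the power \<open>p\<close>, gives the term of scale
  \<open>k\<close> below. Summing over all \<open>k \<ge> K\<close> makes the bound independent of the scale of the pair,
  with a single function in place of one for each annulus. The factor \<open>\<theta>\<^sup>k\<close>
  keeps the sum integrable although the \<open>g\<^sub>k\<close> are only uniformly bounded in \<open>L\<^sup>p\<close>.
\<close>
lemma oscillation_majorant_of_gradient:
  assumes qm: "quasi_metric_on (space M) d" and g: "g \<in> fractional_gradients \<alpha> d M u"
    and \<alpha>: "0 < \<alpha>" and p: "0 < p" and S: "0 \<le> S"
    and gS: "\<And>k. (\<integral>\<^sup>+x. ennreal (\<bar>g k x\<bar> powr p) \<partial>M) \<le> ennreal S"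
  defines "\<theta> \<equiv> (1 / 2) powr (\<alpha> * p)"
  shows "\<exists>h. oscillation_majorant p d M ((1 / 2) ^ K) u h \<and>
    (\<integral>\<^sup>+x. h x \<partial>M) \<le> ennreal (2 powr p * S / (1 - \<theta>) * \<theta> ^ K)"
proof -
  have \<theta>: "0 < \<theta>" "\<theta> < 1"
    using \<alpha> p powr_less_mono2_neg[of "- (\<alpha> * p)" 1 2]
    by (auto simp: \<theta>_def powr_divide powr_minus divide_simps)
  define T where "T i x = ennreal (2 powr p * \<theta> ^ (K + i)) *
    ennreal (\<bar>g (int (K + i)) x\<bar> powr p)" for i x
  define h where "h x = (\<Sum>i. T i x)" for x
  have gm[measurable]: "g k \<in> borel_measurable M" for k
    using g by (simp add: fractional_gradients_def)
  have g0: "0 \<le> g k x" if "x \<in> space M" for k x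
    using g that by (simp add: fractional_gradients_def)
  have Tm[measurable]: "T i \<in> borel_measurable M" for i
    unfolding T_def by measurable
  from g obtain E where E: "E \<in> null_sets M" and gE: "\<And>k x y. x \<in> space M - E \<Longrightarrow>
      y \<in> space M - E \<Longrightarrow> 2 powi (- k - 1) \<le> d x y \<Longrightarrow> d x y < 2 powi (- k) \<Longrightarrow>
      \<bar>u x - u y\<bar> \<le> d x y powr \<alpha> * (g k x + g k y)"
    unfolding fractional_gradients_def by blast
  have "ennreal (\<bar>u x - u y\<bar> powr p) \<le> h x + h y"
    if x: "x \<in> space M - E" and y: "y \<in> space M - E" and dxy: "d x y < (1 / 2) ^ K" for x y
  proof (cases "x = y")
    case False
    with qm x y have d: "0 < d x y"
      unfolding quasi_metric_on_def by (metis DiffD1 order_le_less)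
    from dyadic_scale[OF d dxy] obtain i where
      i: "(1 / 2) ^ Suc (K + i) \<le> d x y" "d x y < (1 / 2) ^ (K + i)" by blast
    define k where "k = int (K + i)"
    have "2 powi (- k) = (1 / 2 :: real) ^ (K + i)"
      by (simp add: k_def power_int_minus power_one_over del: of_nat_add) (simp add: field_simps)
    moreover have "- k - 1 = - int (Suc (K + i))" by (simp add: k_def)
    hence "2 powi (- k - 1) = (1 / 2 :: real) ^ Suc (K + i)"
      by (simp add: power_int_minus power_one_over del: of_nat_add of_nat_Suc power_Suc) 
         (simp add: field_simps)
    ultimately have "\<bar>u x - u y\<bar> \<le> d x y powr \<alpha> * (g k x + g k y)"
      using gE[OF x y, of k] i by simp
    hence "\<bar>u x - u y\<bar> powr p \<le> (d x y powr \<alpha> * (g k x + g k y)) powr p"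
      using p by (intro powr_mono2) auto
    also have "\<dots> = d x y powr (\<alpha> * p) * \<bar>g k x + g k y\<bar> powr p"
      using x y g0[of x k] g0[of y k] by (simp add: powr_mult powr_powr)
    also have "\<dots> \<le> \<theta> ^ (K + i) * (2 powr p * (\<bar>g k x\<bar> powr p + \<bar>g k y\<bar> powr p))"
    proof (intro mult_mono powr_sum_le)
      have "d x y powr (\<alpha> * p) \<le> ((1 / 2) ^ (K + i)) powr (\<alpha> * p)"
        using i d \<alpha> p by (intro powr_mono2) auto
      also have "\<dots> = \<theta> ^ (K + i)"
        unfolding \<theta>_def by (simp add: powr_power powr_realpow[symmetric] powr_powr ac_simps del: of_nat_add)
      finally show "d x y powr (\<alpha> * p) \<le> \<theta> ^ (K + i)" .
    qed (use \<theta> p in auto)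
    finally have "ennreal (\<bar>u x - u y\<bar> powr p)
      \<le> ennreal (2 powr p * \<theta> ^ (K + i) * \<bar>g k x\<bar> powr p
               + 2 powr p * \<theta> ^ (K + i) * \<bar>g k y\<bar> powr p)"
      by (intro ennreal_leI) (simp add: algebra_simps)
    also have "\<dots> = T i x + T i y"
      using \<theta> by (simp add: T_def k_def ennreal_mult)
    also have "\<dots> \<le> h x + h y"
      unfolding h_def
      using sum_le_suminf[of "\<lambda>i. T i x" "{i}"] sum_le_suminf[of "\<lambda>i. T i y" "{i}"]
      by (intro add_mono) auto
    finally show ?thesis .
  qed simp
  moreover have "(\<integral>\<^sup>+x. h x \<partial>M) \<le> ennreal (2 powr p * S / (1 - \<theta>) * \<theta> ^ K)"
  proof -
    have "(\<integral>\<^sup>+x. h x \<partial>M) = (\<Sum>i. \<integral>\<^sup>+x. T i x \<partial>M)"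
      unfolding h_def by (rule nn_integral_suminf) measurable
    also have "\<dots> \<le> (\<Sum>i. ennreal (2 powr p * S * \<theta> ^ K * \<theta> ^ i))"
    proof (intro suminf_le)
      fix i
      have "(\<integral>\<^sup>+x. T i x \<partial>M) \<le> ennreal (2 powr p * \<theta> ^ (K + i)) * ennreal S"
        unfolding T_def using gS by (subst nn_integral_cmult) (auto intro: mult_left_mono)
      also have "\<dots> = ennreal (2 powr p * S * \<theta> ^ K * \<theta> ^ i)"
        using \<theta> S by (simp add: ennreal_mult[symmetric] power_add ac_simps)
      finally show "(\<integral>\<^sup>+x. T i x \<partial>M) \<le> \<dots>" .
    qed auto
    also have "\<dots> = ennreal (\<Sum>i. 2 powr p * S * \<theta> ^ K * \<theta> ^ i)"
      using \<theta> S by (intro suminf_ennreal2 summable_mult summable_geometric) auto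
    also have "(\<Sum>i. 2 powr p * S * \<theta> ^ K * \<theta> ^ i) = 2 powr p * S / (1 - \<theta>) * \<theta> ^ K"
      using \<theta> by (simp add: suminf_mult summable_geometric suminf_geometric)
    finally show ?thesis .
  qed
  moreover have "h \<in> borel_measurable M"
    unfolding h_def by measurable
  ultimately show ?thesis
    using E unfolding oscillation_majorant_def by blast
qed

lemma uniform_oscillation_majorants:
  assumes qm: "quasi_metric_on (space M) d" and \<alpha>: "0 < \<alpha>" and p: "0 < p" and "0 \<le> R"
    and gr: "\<And>u. u \<in> B \<Longrightarrow>
      \<exists>g\<in>fractional_gradients \<alpha> d M u. \<forall>k. Lp_norm p M (g k) \<le> ennreal R"
    and \<eta>: "0 < \<eta>"
  shows "\<exists>r>0. \<forall>u\<in>B. \<exists>h. oscillation_majorant p d M r u h \<and> (\<integral>\<^sup>+x. h x \<partial>M) \<le> ennreal \<eta>"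
proof -
  define \<theta> :: real where "\<theta> = (1 / 2) powr (\<alpha> * p)"
  have \<theta>: "0 < \<theta>" "\<theta> < 1"
    using \<alpha> p powr_less_mono2_neg[of "- (\<alpha> * p)" 1 2]
    by (auto simp: \<theta>_def powr_divide powr_minus divide_simps)
  define A where "A = 2 powr p * R powr p / (1 - \<theta>)"
  have "(\<lambda>K. A * \<theta> ^ K) \<longlonglongrightarrow> A * 0"
    using \<theta> by (intro tendsto_mult LIMSEQ_realpow_zero) auto
  hence "eventually (\<lambda>K. A * \<theta> ^ K < \<eta>) sequentially"
    using \<eta> by (intro order_tendstoD) auto
  then obtain K where K: "A * \<theta> ^ K < \<eta>" by (auto simp: eventually_sequentially)
  have "\<exists>h. oscillation_majorant p d M ((1 / 2) ^ K) u h \<and> (\<integral>\<^sup>+x. h x \<partial>M) \<le> ennreal \<eta>"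
    if u: "u \<in> B" for u
  proof -
    from gr[OF u] obtain g where g: "g \<in> fractional_gradients \<alpha> d M u"
      "\<And>k. Lp_norm p M (g k) \<le> ennreal R" by blast
    have "\<exists>h. oscillation_majorant p d M ((1 / 2) ^ K) u h \<and>
        (\<integral>\<^sup>+x. h x \<partial>M) \<le> ennreal (2 powr p * R powr p / (1 - \<theta>) * \<theta> ^ K)"
      unfolding \<theta>_def using p \<open>0 \<le> R\<close> g
      by (intro oscillation_majorant_of_gradient[OF qm g(1) \<alpha> p])
         (auto intro: integral_powr_le_if_Lp_norm_le)
    with K show ?thesis unfolding A_def[symmetric]
      by (meson ennreal_leI less_imp_le order_trans)
  qed
  thus ?thesis by (intro exI[of _ "(1 / 2) ^ K"]) auto
qed

text \<open>
  The infimum in the norm need not be attained; the summand \<open>1\<close> leaves room for a near-minimiser.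
\<close>
lemma Lp_norm_gradient_le_HTL:
  assumes "HTL_norm \<alpha> p q d M u \<le> ennreal R" "0 < p" "0 < q"
  shows "\<exists>g\<in>fractional_gradients \<alpha> d M u. \<forall>k. Lp_norm p M (g k) \<le> ennreal (\<bar>R\<bar> + 1)"
proof -
  have "(INF g\<in>fractional_gradients \<alpha> d M u. Lp_enorm p M (\<lambda>x. lq_enorm q (\<lambda>k. ennreal (g k x))))
    \<le> ennreal R"
    using assms(1) unfolding HTL_norm_def by (rule order_trans[rotated]) (simp add: add_increasing)
  also have "\<dots> < ennreal (\<bar>R\<bar> + 1)" by (intro ennreal_lessI) auto
  finally obtain g where g: "g \<in> fractional_gradients \<alpha> d M u"
    "Lp_enorm p M (\<lambda>x. lq_enorm q (\<lambda>k. ennreal (g k x))) < ennreal (\<bar>R\<bar> + 1)"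
    unfolding INF_less_iff by blast
  have "Lp_norm p M (g k) \<le> Lp_enorm p M (\<lambda>x. lq_enorm q (\<lambda>k. ennreal (g k x)))" for k
    unfolding Lp_norm_def
  proof (rule Lp_enorm_mono)
    fix x assume "x \<in> space M"
    hence "0 \<le> g k x" using g by (simp add: fractional_gradients_def)
    thus "ennreal \<bar>g k x\<bar> \<le> lq_enorm q (\<lambda>k. ennreal (g k x))"
      using component_le_lq_enorm[OF assms(3), of "\<lambda>k. ennreal (g k x)" k] by simp
  qed fact
  with g show ?thesis by (meson order_trans less_imp_le)
qed

lemma Lp_norm_gradient_le_HB:
  assumes "HB_norm \<alpha> p q d M u \<le> ennreal R" "0 < q"
  shows "\<exists>g\<in>fractional_gradients \<alpha> d M u. \<forall>k. Lp_norm p M (g k) \<le> ennreal (\<bar>R\<bar> + 1)"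
proof -
  have "(INF g\<in>fractional_gradients \<alpha> d M u. lq_enorm q (\<lambda>k. Lp_norm p M (g k))) \<le> ennreal R"
    using assms(1) unfolding HB_norm_def by (rule order_trans[rotated]) (simp add: add_increasing)
  also have "\<dots> < ennreal (\<bar>R\<bar> + 1)" by (intro ennreal_lessI) auto
  finally obtain g where "g \<in> fractional_gradients \<alpha> d M u"
    "lq_enorm q (\<lambda>k. Lp_norm p M (g k)) < ennreal (\<bar>R\<bar> + 1)"
    unfolding INF_less_iff by blast
  thus ?thesis using component_le_lq_enorm[OF assms(2), of "\<lambda>k. Lp_norm p M (g k)"]
    by (meson order_trans less_imp_le)
qed

section \<open>Approximation on small pieces and on the tail\<close>

text \<open>
  The tail is controlled by a weight \<open>w\<close> rather than by the reciprocal measure of the \<open>r\<close>-balls of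
  \<open>d\<close>, since the latter need not be a measurable function of the centre; the neighbourhoods \<open>D\<close> may be balls
  of an equivalent quasi-metric.
\<close>
definition small_pieces_up_to_tail ::
    "('a \<Rightarrow> 'a \<Rightarrow> real) \<Rightarrow> 'a measure \<Rightarrow> 'a measure \<Rightarrow> real \<Rightarrow> real \<Rightarrow> bool" where
  "small_pieces_up_to_tail d M N r \<tau> \<longleftrightarrow>
     (\<exists>(P :: nat \<Rightarrow> 'a set) m w. disjoint_family_on P {..<m} \<and>
        (\<forall>j<m. P j \<in> sets M \<and> emeasure M (P j) < \<infinity> \<and> (\<forall>x\<in>P j. \<forall>y\<in>P j. d x y < r)) \<and>
        w \<in> borel_measurable M \<and>
        (\<forall>x\<in>space M - (\<Union>j<m. P j). \<exists>D\<in>sets M. D \<subseteq> qball (space M) d x r \<and>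
           0 < emeasure M D \<and> emeasure M D < \<infinity> \<and> 1 / emeasure M D \<le> w x) \<and>
        (\<integral>\<^sup>+x\<in>space M - (\<Union>j<m. P j). w x \<partial>N) \<le> ennreal \<tau>)"

text \<open>
  The weight \<open>w\<close> multiplies a quantity that is bounded on the family, while \<open>h\<close> itself enters with
  the factor \<open>C\<close> only. Thus the radius \<open>r\<close> can be fixed, making \<open>\<integral> h\<close> small, before the tail is chosen
  in dependence on \<open>r\<close>.
\<close>
lemma tail_integral_le:
  assumes p: "0 < p" and maj: "oscillation_majorant p d M r u h"
    and um[measurable]: "u \<in> borel_measurable M"
    and A: "A \<in> sets M" and w: "w \<in> borel_measurable M"
    and ball: "\<And>x. x \<in> A \<Longrightarrow> \<exists>D\<in>sets M. D \<subseteq> qball (space M) d x r \<and>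
           0 < emeasure M D \<and> emeasure M D < \<infinity> \<and> 1 / emeasure M D \<le> w x"
    and NM: "sets N = sets M" "\<forall>A\<in>sets M. emeasure N A \<le> ennreal C * emeasure M A"
  shows "(\<integral>\<^sup>+x\<in>A. ennreal (\<bar>u x\<bar> powr p) \<partial>N) \<le> ennreal (2 powr p) *
    (ennreal C * (\<integral>\<^sup>+x. h x \<partial>M) + (\<integral>\<^sup>+x\<in>A. w x \<partial>N) *
      ((\<integral>\<^sup>+x. h x \<partial>M) + (\<integral>\<^sup>+x. ennreal (\<bar>u x\<bar> powr p) \<partial>M)))"
proof -
  from maj obtain E where hm[measurable]: "h \<in> borel_measurable M" and E: "E \<in> null_sets M"
    and osc: "\<And>x y. x \<in> space M - E \<Longrightarrow> y \<in> space M - E \<Longrightarrow> d x y < r \<Longrightarrow>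
      ennreal (\<bar>u x - u y\<bar> powr p) \<le> h x + h y"
    unfolding oscillation_majorant_def by blast
  define f where "f y = h y + ennreal (\<bar>u y\<bar> powr p)" for y
  define J where "J = (\<integral>\<^sup>+y. f y \<partial>M)"
  have J: "J = (\<integral>\<^sup>+x. h x \<partial>M) + (\<integral>\<^sup>+x. ennreal (\<bar>u x\<bar> powr p) \<partial>M)"
    unfolding J_def f_def by (rule nn_integral_add) measurable
  have pointwise: "ennreal (\<bar>u x\<bar> powr p) \<le> ennreal (2 powr p) * (h x + w x * J)"
    if x: "x \<in> A" "x \<notin> E" for x
  proof -
    from ball[OF x(1)] obtain D where D: "D \<in> sets M" "D \<subseteq> qball (space M) d x r"
      "0 < emeasure M D" "emeasure M D < \<infinity>" "1 / emeasure M D \<le> w x" by blast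
    obtain y where y: "y \<in> D - E" "f y * emeasure M D \<le> (\<integral>\<^sup>+x\<in>D. f x \<partial>M)"
      using point_below_average[OF D(1,3,4) E, of f] unfolding f_def by auto
    have "f y = f y * (emeasure M D * (1 / emeasure M D))"
      using D by (simp add: ennreal_times_divide ennreal_divide_self)
    also have "\<dots> = (f y * emeasure M D) * (1 / emeasure M D)" by (simp add: mult.assoc)
    also have "\<dots> \<le> J * w x"
    proof (intro mult_mono D(5) order_trans[OF y(2)])
      show "(\<integral>\<^sup>+x\<in>D. f x \<partial>M) \<le> J" unfolding J_def
        by (intro nn_integral_mono) (auto simp: indicator_def)
    qed auto
    finally have fy: "f y \<le> w x * J" by (simp add: mult.commute)
    have "x \<in> space M - E" "y \<in> space M - E" "d x y < r"
      using x y D A sets.sets_into_space by (auto simp: qball_def)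
    hence "ennreal (\<bar>u x - u y\<bar> powr p) \<le> h x + h y" by (rule osc)
    have "ennreal (\<bar>u x\<bar> powr p) = ennreal (\<bar>(u x - u y) + u y\<bar> powr p)" by simp
    also have "\<dots> \<le> ennreal (2 powr p) *
        (ennreal (\<bar>u x - u y\<bar> powr p) + ennreal (\<bar>u y\<bar> powr p))"
      by (rule ennreal_powr_sum_le[OF p])
    also have "\<dots> \<le> ennreal (2 powr p) * (h x + f y)"
      unfolding f_def add.assoc[symmetric] by (intro mult_left_mono add_right_mono) (fact, simp)
    also have "\<dots> \<le> ennreal (2 powr p) * (h x + w x * J)"
      using fy by (intro mult_left_mono add_left_mono) auto
    finally show ?thesis .
  qed
  have meas: "h \<in> borel_measurable N" "w \<in> borel_measurable N" "A \<in> sets N"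
    using hm w A NM(1) by (auto cong: measurable_cong_sets)
  note [measurable] = meas
  have "AE x in N. x \<notin> E"
    using AE_of_measure_le[OF NM AE_not_in[OF E]] .
  hence "AE x in N. ennreal (\<bar>u x\<bar> powr p) * indicator A x \<le>
      ennreal (2 powr p) * (h x * indicator A x + w x * indicator A x * J)"
    by eventually_elim (use pointwise in \<open>auto simp: indicator_def\<close>)
  hence "(\<integral>\<^sup>+x\<in>A. ennreal (\<bar>u x\<bar> powr p) \<partial>N) \<le>
      (\<integral>\<^sup>+x. ennreal (2 powr p) * (h x * indicator A x + w x * indicator A x * J) \<partial>N)"
    by (rule nn_integral_mono_AE)
  also have "\<dots> = ennreal (2 powr p) * ((\<integral>\<^sup>+x\<in>A. h x \<partial>N) + (\<integral>\<^sup>+x\<in>A. w x \<partial>N) * J)"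
    by (simp add: nn_integral_cmult nn_integral_add nn_integral_multc)
  also have "\<dots> \<le> ennreal (2 powr p) * (ennreal C * (\<integral>\<^sup>+x. h x \<partial>M) + (\<integral>\<^sup>+x\<in>A. w x \<partial>N) * J)"
  proof (intro mult_left_mono add_right_mono)
    have "(\<integral>\<^sup>+x\<in>A. h x \<partial>N) \<le> (\<integral>\<^sup>+x. h x \<partial>N)"
      by (intro nn_integral_mono) (auto simp: indicator_def)
    also have "\<dots> \<le> ennreal C * (\<integral>\<^sup>+x. h x \<partial>M)"
      by (rule nn_integral_le_of_measure_le[OF NM hm])
    finally show "(\<integral>\<^sup>+x\<in>A. h x \<partial>N) \<le> ennreal C * (\<integral>\<^sup>+x. h x \<partial>M)" .
  qed simp
  finally show ?thesis unfolding J .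
qed

text \<open>
  The constant is the value of \<open>u\<close> at a point of \<open>P\<close> where \<open>h\<close> is at most its average. On a null
  piece any constant works, and \<open>0\<close> keeps the constants bounded over a family of functions.
\<close>
lemma constant_approximation_on_piece:
  assumes maj: "oscillation_majorant p d M r u h"
    and um[measurable]: "u \<in> borel_measurable M"
    and P[measurable]: "P \<in> sets M" and Pfin: "emeasure M P < \<infinity>"
    and diam: "\<And>x y. x \<in> P \<Longrightarrow> y \<in> P \<Longrightarrow> d x y < r"
  shows "\<exists>c. (\<integral>\<^sup>+x\<in>P. ennreal (\<bar>u x - c\<bar> powr p) \<partial>M) \<le> 2 * (\<integral>\<^sup>+x\<in>P. h x \<partial>M) \<and>
    (emeasure M P = 0 \<longrightarrow> c = 0)"
proof (cases "emeasure M P = 0")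
  case True
  hence "P \<in> null_sets M" by (simp add: null_sets_def)
  hence "(\<integral>\<^sup>+x\<in>P. ennreal (\<bar>u x - 0\<bar> powr p) \<partial>M) = 0" by (rule nn_integral_null_set)
  thus ?thesis by (intro exI[of _ 0]) simp
next
  case False
  from maj obtain E where hm[measurable]: "h \<in> borel_measurable M" and E: "E \<in> null_sets M"
    and osc: "\<And>x y. x \<in> space M - E \<Longrightarrow> y \<in> space M - E \<Longrightarrow> d x y < r \<Longrightarrow>
      ennreal (\<bar>u x - u y\<bar> powr p) \<le> h x + h y"
    unfolding oscillation_majorant_def by blast
  obtain y where y: "y \<in> P - E" "h y * emeasure M P \<le> (\<integral>\<^sup>+x\<in>P. h x \<partial>M)"
    using point_below_average[OF P _ Pfin E hm] False by (auto simp: zero_less_iff_neq_zero)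
  have sub: "P \<subseteq> space M" using P by (rule sets.sets_into_space)
  have pointwise: "ennreal (\<bar>u x - u y\<bar> powr p) \<le> h x + h y" if "x \<in> P" "x \<notin> E" for x
    using osc[of x y] diam[of x y] y sub that by blast
  have "AE x in M. x \<notin> E" by (rule AE_not_in[OF E])
  hence "AE x in M. ennreal (\<bar>u x - u y\<bar> powr p) * indicator P x \<le>
      h x * indicator P x + h y * indicator P x"
    by eventually_elim (use pointwise in \<open>auto simp: indicator_def\<close>)
  hence "(\<integral>\<^sup>+x\<in>P. ennreal (\<bar>u x - u y\<bar> powr p) \<partial>M) \<le>
      (\<integral>\<^sup>+x. h x * indicator P x + h y * indicator P x \<partial>M)"
    by (rule nn_integral_mono_AE)
  also have "\<dots> = (\<integral>\<^sup>+x\<in>P. h x \<partial>M) + h y * emeasure M P"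
    by (simp add: nn_integral_add nn_integral_cmult_indicator)
  also have "\<dots> \<le> (\<integral>\<^sup>+x\<in>P. h x \<partial>M) + (\<integral>\<^sup>+x\<in>P. h x \<partial>M)"
    using y by (intro add_left_mono)
  finally show ?thesis using False by (intro exI[of _ "u y"]) (auto simp: mult_2)
qed

text \<open>
  Bounded coefficients are what makes finitely many step functions suffice: a constant close to \<open>u\<close>
  on a piece of positive measure cannot be large, since the \<open>L\<^sup>p\<close>-norm of \<open>u\<close> is bounded.
\<close>
lemma constant_bound:
  assumes p: "0 < p" and um[measurable]: "u \<in> borel_measurable M"
    and P[measurable]: "P \<in> sets M" and m: "emeasure M P = ennreal m" "0 < m"
    and u: "(\<integral>\<^sup>+x. ennreal (\<bar>u x\<bar> powr p) \<partial>M) \<le> ennreal S" "0 \<le> S"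
    and c: "(\<integral>\<^sup>+x\<in>P. ennreal (\<bar>u x - c\<bar> powr p) \<partial>M) \<le> ennreal T" "0 \<le> T"
  shows "\<bar>c\<bar> \<le> (2 powr p * (T + S) / m) powr (1 / p)"
proof -
  have "ennreal (\<bar>c\<bar> powr p * m) = (\<integral>\<^sup>+x\<in>P. ennreal (\<bar>c\<bar> powr p) \<partial>M)"
    using m by (simp add: nn_integral_cmult_indicator ennreal_mult)
  also have "\<dots> \<le> (\<integral>\<^sup>+x. ennreal (2 powr p) * (ennreal (\<bar>u x - c\<bar> powr p) * indicator P x
      + ennreal (\<bar>u x\<bar> powr p)) \<partial>M)"
  proof (intro nn_integral_mono)
    fix x
    show "ennreal (\<bar>c\<bar> powr p) * indicator P x \<le> ennreal (2 powr p) *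
        (ennreal (\<bar>u x - c\<bar> powr p) * indicator P x + ennreal (\<bar>u x\<bar> powr p))"
      using ennreal_powr_sum_le[OF p, of "c - u x" "u x"]
      by (auto simp: indicator_def abs_minus_commute)
  qed
  also have "\<dots> = ennreal (2 powr p) * ((\<integral>\<^sup>+x\<in>P. ennreal (\<bar>u x - c\<bar> powr p) \<partial>M)
      + (\<integral>\<^sup>+x. ennreal (\<bar>u x\<bar> powr p) \<partial>M))"
    by (simp add: nn_integral_cmult nn_integral_add)
  also have "\<dots> \<le> ennreal (2 powr p) * (ennreal T + ennreal S)"
    using u c by (intro mult_left_mono add_mono) auto
  also have "\<dots> = ennreal (2 powr p * (T + S))"
    using u c by (simp add: ennreal_mult)
  finally have "\<bar>c\<bar> powr p * m \<le> 2 powr p * (T + S)"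
    using u c by (simp add: ennreal_le_iff)
  hence "\<bar>c\<bar> powr p \<le> 2 powr p * (T + S) / m" using m by (simp add: field_simps)
  hence "(\<bar>c\<bar> powr p) powr (1 / p) \<le> (2 powr p * (T + S) / m) powr (1 / p)"
    using p by (intro powr_mono2) auto
  thus ?thesis using p by (simp add: powr_powr)
qed

lemma sum_integral_pieces_le:
  fixes m :: nat
  assumes "disjoint_family_on P {..<m}" "\<And>j. j < m \<Longrightarrow> P j \<in> sets M"
    "f \<in> borel_measurable M"
  shows "(\<Sum>j<m. \<integral>\<^sup>+x\<in>P j. f x \<partial>M) \<le> (\<integral>\<^sup>+x. f x \<partial>M)"
proof -
  have "(\<Sum>j<m. \<integral>\<^sup>+x\<in>P j. f x \<partial>M) = (\<integral>\<^sup>+x. (\<Sum>j<m. f x * indicator (P j) x) \<partial>M)"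
    using assms by (intro nn_integral_sum[symmetric]) auto
  also have "\<dots> = (\<integral>\<^sup>+x. f x * indicator (\<Union>j<m. P j) x \<partial>M)"
  proof (intro nn_integral_cong)
    fix x
    have "indicator (\<Union>j<m. P j) x = (\<Sum>j<m. indicator (P j) x :: ennreal)"
      using assms(1) by (intro indicator_UN_disjoint) auto
    thus "(\<Sum>j<m. f x * indicator (P j) x) = f x * indicator (\<Union>j<m. P j) x"
      by (simp only: sum_distrib_left)
  qed
  also have "\<dots> \<le> (\<integral>\<^sup>+x. f x \<partial>M)"
    by (intro nn_integral_mono) (auto simp: indicator_def)
  finally show ?thesis .
qed

definition step_function :: "(nat \<Rightarrow> 'a set) \<Rightarrow> nat \<Rightarrow> (nat \<Rightarrow> real) \<Rightarrow> 'a \<Rightarrow> real" where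
  "step_function P m c x = (\<Sum>j<m. c j * indicator (P j) x)"

lemma step_function_on_piece:
  assumes "disjoint_family_on P {..<m}" "j < m" "x \<in> P j"
  shows "step_function P m c x = c j"
proof -
  have "step_function P m c x = (\<Sum>i<m. if i = j then c j else 0)"
    unfolding step_function_def using assms
    by (intro sum.cong) (auto simp: disjoint_family_on_def indicator_def)
  thus ?thesis using assms by simp
qed

lemma step_function_off_pieces: "x \<notin> (\<Union>j<m. P j) \<Longrightarrow> step_function P m c x = 0"
  unfolding step_function_def by (intro sum.neutral) auto

lemma step_function_in_Lp_space:
  assumes p: "0 < p" and disj: "disjoint_family_on P {..<m}"
    and P: "\<And>j. j < m \<Longrightarrow> P j \<in> sets N" "\<And>j. j < m \<Longrightarrow> emeasure N (P j) < \<infinity>"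
  shows "step_function P m c \<in> Lp_space p N"
proof -
  have meas: "step_function P m c \<in> borel_measurable N"
    unfolding step_function_def using P by measurable
  have "(\<integral>\<^sup>+x. ennreal (\<bar>step_function P m c x\<bar> powr p) \<partial>N) \<le>
      (\<integral>\<^sup>+x. (\<Sum>j<m. ennreal (\<bar>c j\<bar> powr p) * indicator (P j) x) \<partial>N)"
  proof (intro nn_integral_mono)
    fix x
    show "ennreal (\<bar>step_function P m c x\<bar> powr p) \<le>
      (\<Sum>j<m. ennreal (\<bar>c j\<bar> powr p) * indicator (P j) x)"
    proof (cases "x \<in> (\<Union>j<m. P j)")
      case True
      then obtain j where j: "j < m" "x \<in> P j" by auto
      have "ennreal (\<bar>step_function P m c x\<bar> powr p) = ennreal (\<bar>c j\<bar> powr p) * indicator (P j) x"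
        using j step_function_on_piece[OF disj j] by simp
      also have "\<dots> \<le> (\<Sum>j<m. ennreal (\<bar>c j\<bar> powr p) * indicator (P j) x)"
        using j by (intro member_le_sum) auto
      finally show ?thesis .
    qed (use p in \<open>simp add: step_function_off_pieces\<close>)
  qed
  also have "\<dots> = (\<Sum>j<m. ennreal (\<bar>c j\<bar> powr p) * emeasure N (P j))"
    using P by (subst nn_integral_sum) (auto simp: nn_integral_cmult_indicator)
  also have "\<dots> < \<infinity>"
    using P by (auto simp: ennreal_mult_less_top)
  finally show ?thesis
    using p meas by (simp add: Lp_space_iff)
qed

text \<open>
  The coefficients \<open>b\<close> are those of the approximating grid function, within \<open>\<delta>\<close> of the constants
  \<open>c\<close> that are adapted to \<open>u\<close>.
\<close>
lemma distance_to_step_function_le: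
  assumes p: "0 < p" and disj: "disjoint_family_on P {..<m}"
    and P: "\<And>j. j < m \<Longrightarrow> P j \<in> sets N" and um[measurable]: "u \<in> borel_measurable N"
    and close: "\<And>j. j < m \<Longrightarrow> \<bar>c j - b j\<bar> \<le> \<delta>"
  shows "(\<integral>\<^sup>+x. ennreal (\<bar>u x - step_function P m b x\<bar> powr p) \<partial>N) \<le>
    (\<integral>\<^sup>+x\<in>space N - (\<Union>j<m. P j). ennreal (\<bar>u x\<bar> powr p) \<partial>N) + ennreal (2 powr p) *
     ((\<Sum>j<m. \<integral>\<^sup>+x\<in>P j. ennreal (\<bar>u x - c j\<bar> powr p) \<partial>N) +
       ennreal (\<delta> powr p) * (\<Sum>j<m. emeasure N (P j)))"
proof -
  define A where "A = space N - (\<Union>j<m. P j)"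
  have [measurable]: "A \<in> sets N" unfolding A_def using P by auto
  have "(\<integral>\<^sup>+x. ennreal (\<bar>u x - step_function P m b x\<bar> powr p) \<partial>N) \<le>
    (\<integral>\<^sup>+x. ennreal (\<bar>u x\<bar> powr p) * indicator A x + (\<Sum>j<m. ennreal (2 powr p) *
       (ennreal (\<bar>u x - c j\<bar> powr p) * indicator (P j) x + ennreal (\<delta> powr p) * indicator (P j) x)) \<partial>N)"
    (is "_ \<le> (\<integral>\<^sup>+x. _ + (\<Sum>j<m. ?g j x) \<partial>N)")
  proof (intro nn_integral_mono)
    fix x assume x: "x \<in> space N"
    show "ennreal (\<bar>u x - step_function P m b x\<bar> powr p) \<le>
      ennreal (\<bar>u x\<bar> powr p) * indicator A x + (\<Sum>j<m. ?g j x)"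
    proof (cases "x \<in> A")
      case True
      thus ?thesis by (auto simp: A_def step_function_off_pieces intro: add_increasing2)
    next
      case False
      then obtain j where j: "j < m" "x \<in> P j" using x by (auto simp: A_def)
      have "ennreal (\<bar>u x - step_function P m b x\<bar> powr p) = ennreal (\<bar>(u x - c j) + (c j - b j)\<bar> powr p)"
        using step_function_on_piece[OF disj j] by simp
      also have "\<dots> \<le> ennreal (2 powr p) *
          (ennreal (\<bar>u x - c j\<bar> powr p) + ennreal (\<bar>c j - b j\<bar> powr p))"
        by (rule ennreal_powr_sum_le[OF p])
      also have "\<dots> \<le> ?g j x"
        using j close[OF j(1)] p
        by (auto intro!: mult_left_mono add_left_mono ennreal_leI powr_mono2)
      also have "\<dots> \<le> (\<Sum>j<m. ?g j x)"
        using j by (intro member_le_sum) auto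
      finally show ?thesis by (rule add_increasing[rotated]) simp
    qed
  qed
  also have "\<dots> = (\<integral>\<^sup>+x\<in>A. ennreal (\<bar>u x\<bar> powr p) \<partial>N) + (\<Sum>j<m. \<integral>\<^sup>+x. ?g j x \<partial>N)"
    using P by (subst nn_integral_add) (auto intro!: nn_integral_sum)
  also have "(\<Sum>j<m. \<integral>\<^sup>+x. ?g j x \<partial>N) = (\<Sum>j<m. ennreal (2 powr p) *
      ((\<integral>\<^sup>+x\<in>P j. ennreal (\<bar>u x - c j\<bar> powr p) \<partial>N) + ennreal (\<delta> powr p) * emeasure N (P j)))"
    using P by (intro sum.cong refl)
      (simp add: nn_integral_cmult nn_integral_add nn_integral_cmult_indicator)
  finally show ?thesis
    by (simp add: A_def sum_distrib_left sum.distrib distrib_left)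
qed

text \<open>
  The error of approximating \<open>u\<close> by a grid step function has three sources: the oscillation \<open>\<eta>\<close>, the
  tail \<open>\<tau>\<close> and the grid width \<open>\<delta>\<close>. They are fixed in this order, since the tail estimate involves
  \<open>\<eta>\<close> and the grid error involves the total measure \<open>V\<close> of the pieces, which depend on \<open>\<eta>\<close> and \<open>\<tau>\<close>.
\<close>
lemma totally_bounded_in_Lp_if_uniform_majorants:
  assumes p: "0 < p" and NM: "sets N = sets M" "\<forall>A\<in>sets M. emeasure N A \<le> ennreal C * emeasure M A"
    and C: "0 < C" and S: "0 \<le> S"
    and um: "\<And>u. u \<in> B \<Longrightarrow> u \<in> borel_measurable M"
    and uS: "\<And>u. u \<in> B \<Longrightarrow> (\<integral>\<^sup>+x. ennreal (\<bar>u x\<bar> powr p) \<partial>M) \<le> ennreal S"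
    and osc: "\<And>\<eta>. 0 < \<eta> \<Longrightarrow> \<exists>r>0. \<forall>u\<in>B. \<exists>h. oscillation_majorant p d M r u h \<and>
      (\<integral>\<^sup>+x. h x \<partial>M) \<le> ennreal \<eta>"
    and pieces: "\<And>r \<tau>. 0 < r \<Longrightarrow> 0 < \<tau> \<Longrightarrow> small_pieces_up_to_tail d M N r \<tau>"
  shows "totally_bounded_in_Lp p N B"
  unfolding totally_bounded_in_Lp_def
proof (intro allI impI)
  fix \<epsilon> :: real assume \<epsilon>: "0 < \<epsilon>"
  define e where "e = \<epsilon> powr p"
  define k :: real where "k = 2 powr p"
  have e: "0 < e" and k: "0 < k" using \<epsilon> by (auto simp: e_def k_def)
  \<comment> \<open>The oscillation occurs three times with factor \<open>k * C\<close>, once on the tail and twice on the pieces;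
     this and the two other errors contribute at most \<open>e / 4\<close> each.\<close>
  define \<eta> where "\<eta> = e / (12 * k * C)"
  have \<eta>: "0 < \<eta>" using e k C by (simp add: \<eta>_def)
  define \<tau> where "\<tau> = e / (4 * k * (\<eta> + S))"
  have \<tau>: "0 < \<tau>" using e k \<eta> S by (simp add: \<tau>_def)
  obtain r where r: "0 < r" and maj: "\<And>u. u \<in> B \<Longrightarrow> \<exists>h. oscillation_majorant p d M r u h \<and>
      (\<integral>\<^sup>+x. h x \<partial>M) \<le> ennreal \<eta>"
    using osc[OF \<eta>] by blast
  obtain P m w where disj: "disjoint_family_on P {..<(m::nat)}"
    and P: "\<And>j. j < m \<Longrightarrow> P j \<in> sets M" and Pfin: "\<And>j. j < m \<Longrightarrow> emeasure M (P j) < \<infinity>"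
    and diam: "\<And>j x y. j < m \<Longrightarrow> x \<in> P j \<Longrightarrow> y \<in> P j \<Longrightarrow> d x y < r"
    and w: "w \<in> borel_measurable M"
    and ball: "\<And>x. x \<in> space M - (\<Union>j<m. P j) \<Longrightarrow> \<exists>D\<in>sets M. D \<subseteq> qball (space M) d x r \<and>
           0 < emeasure M D \<and> emeasure M D < \<infinity> \<and> 1 / emeasure M D \<le> w x"
    and tail: "(\<integral>\<^sup>+x\<in>space M - (\<Union>j<m. P j). w x \<partial>N) \<le> ennreal \<tau>"
    using pieces[OF r \<tau>] unfolding small_pieces_up_to_tail_def by blast
  define A where "A = space M - (\<Union>j<m. P j)"
  have sp: "space N = space M" using NM(1) by (rule sets_eq_imp_space_eq)
  have A: "A \<in> sets M" unfolding A_def using P by auto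
  have Nfin: "emeasure N (P j) < \<infinity>" if "j < m" for j
    using NM(2) P[OF that] Pfin[OF that]
    by (metis ennreal_less_top ennreal_mult_less_top infinity_ennreal_def le_less_trans)
  define V where "V = (\<Sum>j<m. measure N (P j))"
  have V: "(\<Sum>j<m. emeasure N (P j)) = ennreal V" "0 \<le> V"
  proof -
    have "(\<Sum>j<m. emeasure N (P j)) = (\<Sum>j<m. ennreal (measure N (P j)))"
      using Nfin by (intro sum.cong) (auto simp: emeasure_eq_ennreal_measure less_top)
    thus "(\<Sum>j<m. emeasure N (P j)) = ennreal V" by (simp add: V_def)
  qed (simp add: V_def sum_nonneg)
  define \<delta> where "\<delta> = (e / (4 * k * (V + 1))) powr (1 / p)"
  have \<delta>: "0 < \<delta>" using e k V by (simp add: \<delta>_def)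
  have \<delta>p: "\<delta> powr p = e / (4 * k * (V + 1))" using p e k V by (simp add: \<delta>_def powr_powr)
  \<comment> \<open>A bound for all coefficients. Null pieces contribute \<open>0\<close> here, as division by zero gives \<open>0\<close>,
     which matches the choice of the constant \<open>0\<close> on them.\<close>
  define L where "L = (\<Sum>j<m. (k * (2 * \<eta> + S) / measure M (P j)) powr (1 / p))"
  define n where "n = \<lceil>L / \<delta>\<rceil> + 1"
  define F where "F = (\<lambda>a. step_function P m (\<lambda>j. \<delta> * of_int (a j))) ` ({..<m} \<rightarrow>\<^sub>E {- n..n})"
  have "finite F" unfolding F_def by (intro finite_imageI finite_PiE) auto
  moreover have "F \<subseteq> Lp_space p N"
    unfolding F_def using step_function_in_Lp_space[OF p disj] P Nfin NM(1) by auto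
  moreover have "\<exists>f\<in>F. u \<in> Lp_space p N \<and> Lp_norm p N (\<lambda>x. u x - f x) < ennreal \<epsilon>"
    if u: "u \<in> B" for u
  proof -
    note [measurable] = um[OF u]
    have umN[measurable]: "u \<in> borel_measurable N"
      using um[OF u] NM(1) by (simp cong: measurable_cong_sets)
    obtain h where h: "oscillation_majorant p d M r u h" "(\<integral>\<^sup>+x. h x \<partial>M) \<le> ennreal \<eta>"
      using maj[OF u] by blast
    have hm[measurable]: "h \<in> borel_measurable M" using h by (simp add: oscillation_majorant_def)
    have "\<exists>c. \<forall>j. j < m \<longrightarrow>
        (\<integral>\<^sup>+x\<in>P j. ennreal (\<bar>u x - c j\<bar> powr p) \<partial>M) \<le> 2 * (\<integral>\<^sup>+x\<in>P j. h x \<partial>M) \<and>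
        (emeasure M (P j) = 0 \<longrightarrow> c j = 0)"
    proof -
      have "\<exists>c. (\<integral>\<^sup>+x\<in>P j. ennreal (\<bar>u x - c\<bar> powr p) \<partial>M) \<le> 2 * (\<integral>\<^sup>+x\<in>P j. h x \<partial>M) \<and>
          (emeasure M (P j) = 0 \<longrightarrow> c = 0)" if "j < m" for j
        by (rule constant_approximation_on_piece[OF h(1) um[OF u] P Pfin diam]) (use that in auto)
      thus ?thesis by (intro choice) blast
    qed
    then obtain c where c: "\<And>j. j < m \<Longrightarrow>
        (\<integral>\<^sup>+x\<in>P j. ennreal (\<bar>u x - c j\<bar> powr p) \<partial>M) \<le> 2 * (\<integral>\<^sup>+x\<in>P j. h x \<partial>M)"
      and c0: "\<And>j. j < m \<Longrightarrow> emeasure M (P j) = 0 \<Longrightarrow> c j = 0" by blast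
    have cL: "\<bar>c j\<bar> \<le> L" if j: "j < m" for j
    proof (cases "emeasure M (P j) = 0")
      case True
      thus ?thesis using c0[OF j] by (simp add: L_def sum_nonneg)
    next
      case False
      have Pj: "emeasure M (P j) = ennreal (measure M (P j))"
        using Pfin[OF j] by (simp add: emeasure_eq_ennreal_measure less_top)
      have "(\<integral>\<^sup>+x\<in>P j. h x \<partial>M) \<le> (\<integral>\<^sup>+x. h x \<partial>M)"
        by (intro nn_integral_mono) (auto simp: indicator_def)
      hence "2 * (\<integral>\<^sup>+x\<in>P j. h x \<partial>M) \<le> 2 * ennreal \<eta>"
        using h(2) by (intro mult_left_mono) auto
      with c[OF j] have "(\<integral>\<^sup>+x\<in>P j. ennreal (\<bar>u x - c j\<bar> powr p) \<partial>M) \<le> ennreal (2 * \<eta>)"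
        using \<eta> by (simp add: ennreal_mult)
      hence "\<bar>c j\<bar> \<le> (2 powr p * (2 * \<eta> + S) / measure M (P j)) powr (1 / p)"
        using False \<eta> Pj
        by (intro constant_bound[OF p um[OF u] P[OF j] Pj _ uS[OF u] S])
           (auto simp: zero_less_measure_iff)
      also have "\<dots> \<le> L"
        unfolding L_def k_def using j
        by (intro member_le_sum[of j "{..<m}" "\<lambda>j. (2 powr p * (2 * \<eta> + S) / measure M (P j)) powr (1 / p)"]) auto
      finally show ?thesis .
    qed
    define a where "a = restrict (\<lambda>j. \<lfloor>c j / \<delta>\<rfloor>) {..<m}"
    have aF: "a \<in> {..<m} \<rightarrow>\<^sub>E {- n..n}"
      unfolding a_def
    proof (intro restrict_PiE_iff[THEN iffD2] ballI)
      fix j assume "j \<in> {..<m}"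
      hence "- L \<le> c j" "c j \<le> L" using cL[of j] by auto
      hence "- (L / \<delta>) \<le> c j / \<delta>" "c j / \<delta> \<le> L / \<delta>"
        using \<delta> divide_right_mono[of "- L" "c j" \<delta>] by (auto simp: divide_right_mono)
      thus "\<lfloor>c j / \<delta>\<rfloor> \<in> {- n..n}"
        unfolding n_def atLeastAtMost_iff by (intro conjI; linarith)
    qed
    define f where "f = step_function P m (\<lambda>j. \<delta> * of_int (a j))"
    have fF: "f \<in> F" unfolding f_def F_def using aF by blast
    have "(\<integral>\<^sup>+x. ennreal (\<bar>u x - f x\<bar> powr p) \<partial>N) \<le>
      (\<integral>\<^sup>+x\<in>A. ennreal (\<bar>u x\<bar> powr p) \<partial>N) + ennreal k *
       ((\<Sum>j<m. \<integral>\<^sup>+x\<in>P j. ennreal (\<bar>u x - c j\<bar> powr p) \<partial>N) + ennreal (\<delta> powr p) * ennreal V)"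
      unfolding f_def A_def k_def sp[symmetric] V(1)[symmetric]
    proof (rule distance_to_step_function_le[OF p disj _ umN])
      fix j assume j: "j < m"
      have "c j - \<delta> * of_int \<lfloor>c j / \<delta>\<rfloor> = \<delta> * frac (c j / \<delta>)"
        using \<delta> by (simp add: frac_def field_simps)
      thus "\<bar>c j - \<delta> * of_int (a j)\<bar> \<le> \<delta>"
        using \<delta> j frac_lt_1[of "c j / \<delta>"] by (simp add: a_def abs_mult mult_le_cancel_left1)
    qed (use P NM(1) in auto)
    also have "\<dots> \<le> ennreal k * (ennreal C * ennreal \<eta> + ennreal \<tau> * (ennreal \<eta> + ennreal S)) +
       ennreal k * (ennreal C * (2 * ennreal \<eta>) + ennreal (\<delta> powr p) * ennreal V)"
    proof (intro add_mono mult_left_mono order_refl)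
      have "(\<integral>\<^sup>+x\<in>A. ennreal (\<bar>u x\<bar> powr p) \<partial>N) \<le> ennreal (2 powr p) *
        (ennreal C * (\<integral>\<^sup>+x. h x \<partial>M) + (\<integral>\<^sup>+x\<in>A. w x \<partial>N) *
          ((\<integral>\<^sup>+x. h x \<partial>M) + (\<integral>\<^sup>+x. ennreal (\<bar>u x\<bar> powr p) \<partial>M)))"
        by (rule tail_integral_le[OF p h(1) um[OF u] A w ball NM]) (simp add: A_def)
      also have "\<dots> \<le> ennreal (2 powr p) *
          (ennreal C * ennreal \<eta> + ennreal \<tau> * (ennreal \<eta> + ennreal S))"
        using h(2) tail uS[OF u] unfolding A_def
        by (intro mult_left_mono add_mono mult_mono) auto
      finally show "(\<integral>\<^sup>+x\<in>A. ennreal (\<bar>u x\<bar> powr p) \<partial>N) \<le>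
          ennreal k * (ennreal C * ennreal \<eta> + ennreal \<tau> * (ennreal \<eta> + ennreal S))"
        by (simp add: k_def)
      have "(\<Sum>j<m. \<integral>\<^sup>+x\<in>P j. ennreal (\<bar>u x - c j\<bar> powr p) \<partial>N)
        \<le> (\<Sum>j<m. ennreal C * (2 * (\<integral>\<^sup>+x\<in>P j. h x \<partial>M)))"
      proof (intro sum_mono)
        fix j assume "j \<in> {..<m}"
        hence j: "j < m" by simp
        have "(\<integral>\<^sup>+x\<in>P j. ennreal (\<bar>u x - c j\<bar> powr p) \<partial>N)
          \<le> ennreal C * (\<integral>\<^sup>+x\<in>P j. ennreal (\<bar>u x - c j\<bar> powr p) \<partial>M)"
        proof (intro nn_integral_le_of_measure_le[OF NM])
          have [measurable]: "P j \<in> sets M" using P[OF j] .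
          show "(\<lambda>x. ennreal (\<bar>u x - c j\<bar> powr p) * indicator (P j) x) \<in> borel_measurable M"
            by measurable
        qed
        also have "\<dots> \<le> ennreal C * (2 * (\<integral>\<^sup>+x\<in>P j. h x \<partial>M))"
          using c[OF j] by (intro mult_left_mono) auto
        finally show "(\<integral>\<^sup>+x\<in>P j. ennreal (\<bar>u x - c j\<bar> powr p) \<partial>N) \<le> \<dots>" .
      qed
      also have "\<dots> = ennreal C * (2 * (\<Sum>j<m. \<integral>\<^sup>+x\<in>P j. h x \<partial>M))"
        by (simp add: sum_distrib_left)
      also have "\<dots> \<le> ennreal C * (2 * ennreal \<eta>)"
        using sum_integral_pieces_le[OF disj P hm] h(2)
        by (intro mult_left_mono) (auto intro: order_trans)
      finally show "(\<Sum>j<m. \<integral>\<^sup>+x\<in>P j. ennreal (\<bar>u x - c j\<bar> powr p) \<partial>N)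
          \<le> ennreal C * (2 * ennreal \<eta>)" .
    qed auto
    also have "\<dots> = ennreal (k * (C * \<eta> + \<tau> * (\<eta> + S)) + k * (C * (2 * \<eta>) + \<delta> powr p * V))"
      using k C \<eta> \<tau> S V by (simp add: ennreal_mult)
    also have "\<dots> < ennreal e"
    proof (rule ennreal_lessI[OF e])
      have "k * C * \<eta> = e / 12" using k C by (simp add: \<eta>_def)
      moreover have "k * (\<tau> * (\<eta> + S)) = e / 4"
      proof -
        have "\<eta> + S \<noteq> 0" using \<eta> S by linarith
        thus ?thesis using k by (simp add: \<tau>_def)
      qed
      moreover have "k * (\<delta> powr p * V) \<le> e / 4"
      proof -
        have "k * (\<delta> powr p * V) = e / 4 * (V / (V + 1))" using k by (simp add: \<delta>p)
        also have "\<dots> \<le> e / 4 * 1" using e V by (intro mult_left_mono) auto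
        finally show ?thesis by simp
      qed
      ultimately show "k * (C * \<eta> + \<tau> * (\<eta> + S)) + k * (C * (2 * \<eta>) + \<delta> powr p * V) < e"
        using e by (simp add: algebra_simps)
    qed
    finally have "Lp_norm p N (\<lambda>x. u x - f x) < ennreal \<epsilon>"
      unfolding e_def by (rule Lp_norm_less_if_integral_powr_less[OF p \<epsilon>])
    moreover have "u \<in> Lp_space p N"
    proof -
      have "(\<integral>\<^sup>+x. ennreal (\<bar>u x\<bar> powr p) \<partial>N) \<le> ennreal C * (\<integral>\<^sup>+x. ennreal (\<bar>u x\<bar> powr p) \<partial>M)"
        by (intro nn_integral_le_of_measure_le[OF NM]) measurable
      also have "\<dots> < \<infinity>"
        using uS[OF u] by (auto simp: ennreal_mult_less_top intro: le_less_trans)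
      finally show ?thesis using p umN by (simp add: Lp_space_iff)
    qed
    ultimately show ?thesis using fF by blast
  qed
  hence "B \<subseteq> (\<Union>f\<in>F. {u \<in> Lp_space p N. Lp_norm p N (\<lambda>x. u x - f x) < ennreal \<epsilon>})" by blast
  ultimately show "\<exists>F. finite F \<and> F \<subseteq> Lp_space p N \<and>
      B \<subseteq> (\<Union>f\<in>F. {u \<in> Lp_space p N. Lp_norm p N (\<lambda>x. u x - f x) < ennreal \<epsilon>})" by blast
qed


section \<open>Splitting the space into small pieces and a tail\<close>

text \<open>It suffices to cover: a finite cover is made disjoint by removing earlier members.\<close>
lemma small_pieces_up_to_tailI:
  assumes F: "finite F"
    and Q: "\<And>z. z \<in> F \<Longrightarrow> Q z \<in> sets M" "\<And>z. z \<in> F \<Longrightarrow> emeasure M (Q z) < \<infinity>"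
      "\<And>z x y. z \<in> F \<Longrightarrow> x \<in> Q z \<Longrightarrow> y \<in> Q z \<Longrightarrow> d x y < r"
    and w: "w \<in> borel_measurable M"
    and ball: "\<And>x. x \<in> space M - (\<Union>z\<in>F. Q z) \<Longrightarrow> \<exists>D\<in>sets M. D \<subseteq> qball (space M) d x r \<and>
           0 < emeasure M D \<and> emeasure M D < \<infinity> \<and> 1 / emeasure M D \<le> w x"
    and tail: "(\<integral>\<^sup>+x\<in>space M - (\<Union>z\<in>F. Q z). w x \<partial>N) \<le> ennreal \<tau>"
  shows "small_pieces_up_to_tail d M N r \<tau>"
proof -
  from F obtain zs where zs: "set zs = F" using finite_list by blast
  define m where "m = length zs"
  define P where "P = disjointed (\<lambda>j. Q (zs ! j))"
  have zsF: "zs ! j \<in> F" if "j < m" for j using that zs by (auto simp: m_def)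
  have UN: "(\<Union>j<m. P j) = (\<Union>z\<in>F. Q z)"
  proof -
    have "(\<Union>j<m. P j) = (\<Union>j<m. Q (zs ! j))"
      using finite_UN_disjointed_eq[of "\<lambda>j. Q (zs ! j)" m] by (simp add: P_def lessThan_atLeast0)
    also have "\<dots> = (\<Union>z\<in>F. Q z)"
      unfolding zs[symmetric] by (force simp: m_def in_set_conv_nth)
    finally show ?thesis .
  qed
  have sub: "P j \<subseteq> Q (zs ! j)" for j unfolding P_def by (rule disjointed_subset)
  have PM: "P j \<in> sets M" if "j < m" for j
    unfolding P_def disjointed_def using that by (auto intro!: Q(1) zsF sets.Diff sets.finite_UN)
  have "disjoint_family_on P {..<m}"
    using disjoint_family_disjointed[of "\<lambda>j. Q (zs ! j)"]
    unfolding P_def by (rule disjoint_family_on_mono[rotated]) simp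
  moreover have "emeasure M (P j) < \<infinity>" if "j < m" for j
    using emeasure_mono[OF sub Q(1)[OF zsF[OF that]]] Q(2)[OF zsF[OF that]] by (rule le_less_trans)
  moreover have "d x y < r" if "j < m" "x \<in> P j" "y \<in> P j" for j x y
    using Q(3)[OF zsF[OF that(1)]] sub that by blast
  ultimately show ?thesis
    unfolding small_pieces_up_to_tail_def
    using PM w ball tail
    by (intro exI[of _ P] exI[of _ m] exI[of _ w]) (simp add: UN)
qed

text \<open>
  One constant for all orders of the arguments, so that neither the constant of quasi-symmetry nor
  that of the quasi-triangle inequality has to be tracked.
\<close>
lemma quasi_triangle:
  assumes "quasi_metric_on X d"
  obtains c where "0 < c" "\<And>t x y z. x \<in> X \<Longrightarrow> y \<in> X \<Longrightarrow> z \<in> X \<Longrightarrow>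
    d x y < t \<or> d y x < t \<Longrightarrow> d y z < t \<or> d z y < t \<Longrightarrow> d x z < c * t"
proof -
  from assms obtain C0 C1 where C: "0 < C0" "0 < C1"
    and sym: "\<And>x y. x \<in> X \<Longrightarrow> y \<in> X \<Longrightarrow> d y x \<le> C0 * d x y"
    and tri: "\<And>x y z. x \<in> X \<Longrightarrow> y \<in> X \<Longrightarrow> z \<in> X \<Longrightarrow> d x y \<le> C1 * max (d x z) (d z y)"
    and nonneg: "\<And>x y. x \<in> X \<Longrightarrow> y \<in> X \<Longrightarrow> 0 \<le> d x y"
    unfolding quasi_metric_on_def by metis
  have one: "d x y < (C0 + 1) * t" if "x \<in> X" "y \<in> X" "d x y < t \<or> d y x < t" for x y t
  proof -
    have t: "0 < t" using that nonneg[of x y] nonneg[of y x] by linarith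
    have "C0 * d y x < C0 * t" if "d y x < t" using that C by simp
    moreover have "0 < C0 * t" using C t by simp
    ultimately show ?thesis
      using that sym[of y x] t by (auto simp: distrib_right)
  qed
  show thesis
  proof (rule that[of "C1 * (C0 + 1)"])
    fix t x y z
    assume "x \<in> X" "y \<in> X" "z \<in> X" "d x y < t \<or> d y x < t" "d y z < t \<or> d z y < t"
    hence "max (d x y) (d y z) < (C0 + 1) * t" "d x z \<le> C1 * max (d x y) (d y z)"
      using one tri by auto
    thus "d x z < C1 * (C0 + 1) * t"
      using C by (smt (verit) mult.assoc mult_less_cancel_left_pos)
  qed (use C in auto)
qed

lemma small_pieces_if_totally_bounded:
  assumes qmm: "quasi_metric_measure_space d M"
    and tb: "totally_bounded_quasi_metric (space M) d" and r: "0 < r"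
  shows "small_pieces_up_to_tail d M N r \<tau>"
proof -
  have qm: "quasi_metric_on (space M) d" using qmm by (simp add: quasi_metric_measure_space_def)
  obtain c where c: "0 < c" "\<And>t x y z. x \<in> space M \<Longrightarrow> y \<in> space M \<Longrightarrow> z \<in> space M \<Longrightarrow>
    d x y < t \<or> d y x < t \<Longrightarrow> d y z < t \<or> d z y < t \<Longrightarrow> d x z < c * t"
    using quasi_triangle[OF qm] by metis
  define t where "t = r / c"
  have t: "0 < t" "c * t = r" using r c by (auto simp: t_def)
  obtain F where F: "finite F" "F \<subseteq> space M" "space M \<subseteq> (\<Union>x\<in>F. qball (space M) d x t)"
    using tb[unfolded totally_bounded_quasi_metric_def, rule_format, OF t(1)] by (elim exE conjE)
  have empty: "space M - (\<Union>x\<in>F. qball (space M) d x t) = {}"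
    using F(3) by (simp only: Diff_eq_empty_iff)
  show ?thesis
  proof (rule small_pieces_up_to_tailI[OF F(1), where Q = "\<lambda>z. qball (space M) d z t" and w = "\<lambda>_. 0"])
    fix z x y assume "z \<in> F" "x \<in> qball (space M) d z t" "y \<in> qball (space M) d z t"
    thus "d x y < r" using c(2)[of x z y t] t F(2) by (auto simp: qball_def)
  qed (use qmm F t in \<open>auto simp: quasi_metric_measure_space_def empty\<close>)
qed

text \<open>
  Disjoint sets of measure at least \<open>1/K\<close> inside a set of finite measure are bounded in number, so a
  disjoint family of greatest cardinality exists, and no further member can be added to it.
\<close>
lemma finite_maximal_disjoint_family:
  fixes K :: real
  assumes B: "\<And>x. x \<in> G \<Longrightarrow> B x \<in> sets M" "\<And>x. x \<in> G \<Longrightarrow> B x \<noteq> {}"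
    and sub: "\<And>x. x \<in> G \<Longrightarrow> B x \<subseteq> W" and W: "W \<in> sets M" "emeasure M W < \<infinity>"
    and big: "\<And>x. x \<in> G \<Longrightarrow> 1 \<le> ennreal K * emeasure M (B x)"
  shows "\<exists>F. finite F \<and> F \<subseteq> G \<and> (\<forall>x\<in>G. \<exists>z\<in>F. B x \<inter> B z \<noteq> {})"
proof -
  define \<phi> where "\<phi> k \<longleftrightarrow> (\<exists>F. finite F \<and> F \<subseteq> G \<and> disjoint_family_on B F \<and> card F = k)" for k
  have "\<phi> 0" unfolding \<phi>_def by (intro exI[of _ "{}"]) (auto simp: disjoint_family_on_def)
  define b where "b = enn2real (ennreal K * emeasure M W)"
  have b: "ennreal K * emeasure M W = ennreal b"
    using W by (simp add: b_def ennreal_mult_less_top)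
  have bound: "k \<le> nat \<lceil>b\<rceil>" if "\<phi> k" for k
  proof -
    from that obtain F where F: "finite F" "F \<subseteq> G" "disjoint_family_on B F" "card F = k"
      unfolding \<phi>_def by blast
    have "ennreal (real k) = (\<Sum>x\<in>F. 1)" using F by (simp add: ennreal_of_nat_eq_real_of_nat)
    also have "\<dots> \<le> (\<Sum>x\<in>F. ennreal K * emeasure M (B x))"
      using F big by (intro sum_mono) auto
    also have "\<dots> = ennreal K * emeasure M (\<Union>x\<in>F. B x)"
      using F B(1) by (subst sum_emeasure[symmetric]) (auto simp: sum_distrib_left)
    also have "\<dots> \<le> ennreal K * emeasure M W"
      using F sub W by (intro mult_left_mono emeasure_mono) auto
    finally have "ennreal (real k) \<le> ennreal b" unfolding b .
    hence "real k \<le> b" by (simp add: b_def ennreal_le_iff)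
    thus ?thesis by linarith
  qed
  obtain k where k: "\<phi> k" "\<And>l. \<phi> l \<Longrightarrow> l \<le> k"
    using Nat.ex_has_greatest_nat[of \<phi> 0 "nat \<lceil>b\<rceil>"] \<open>\<phi> 0\<close> bound by auto
  then obtain F where F: "finite F" "F \<subseteq> G" "disjoint_family_on B F" "card F = k"
    unfolding \<phi>_def by blast
  have "\<exists>z\<in>F. B x \<inter> B z \<noteq> {}" if x: "x \<in> G" for x
  proof (rule ccontr)
    assume none: "\<not> ?thesis"
    hence "x \<notin> F" using B(2)[OF x] by auto
    moreover have "disjoint_family_on B (insert x F)"
      using F(3) none unfolding disjoint_family_on_def by blast
    ultimately have "\<phi> (Suc k)"
      unfolding \<phi>_def using F x by (intro exI[of _ "insert x F"]) auto
    with k(2) show False by fastforce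
  qed
  with F show ?thesis by blast
qed

text \<open>
  The sets \<open>G n\<close> of points close to \<open>x0\<close> whose balls are not too small increase to the whole space,
  so by dominated convergence the integral of \<open>w\<close> over the complement of \<open>G n\<close> tends to \<open>0\<close>. On \<open>G n\<close>, a
  maximal disjoint family of balls is finite.
\<close>
lemma small_pieces_if_measure_integrable:
  assumes qmm: "quasi_metric_measure_space d M" and int: "measure_integrable_wrt d M N"
    and NM: "sets N = sets M" and r: "0 < r" and \<tau>: "0 < \<tau>"
  shows "small_pieces_up_to_tail d M N r \<tau>"
proof -
  define X where "X = space M"
  have qm: "quasi_metric_on X d" and dball: "\<And>x t. x \<in> X \<Longrightarrow> 0 < t \<Longrightarrow> qball X d x t \<in> sets M"
    and dball_pos: "\<And>x t. x \<in> X \<Longrightarrow> 0 < t \<Longrightarrow> 0 < emeasure M (qball X d x t)"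
    and dball_fin: "\<And>x t. x \<in> X \<Longrightarrow> 0 < t \<Longrightarrow> emeasure M (qball X d x t) < \<infinity>"
    using qmm by (auto simp: quasi_metric_measure_space_def X_def)
  from int obtain \<rho> where qm\<rho>: "quasi_metric_on X \<rho>"
    and equiv: "equivalent_quasi_metrics X d \<rho>"
    and \<rho>ball: "\<And>x t. x \<in> X \<Longrightarrow> 0 < t \<Longrightarrow> qball X \<rho> x t \<in> sets M"
    and \<rho>meas: "\<And>t. 0 < t \<Longrightarrow> (\<lambda>x. emeasure M (qball X \<rho> x t)) \<in> borel_measurable M"
    and \<rho>int: "\<And>t. 0 < t \<Longrightarrow> (\<integral>\<^sup>+x. 1 / emeasure M (qball X \<rho> x t) \<partial>N) < \<infinity>"
    unfolding measure_integrable_wrt_def X_def by blast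
  from equiv obtain \<kappa> where \<kappa>: "0 < \<kappa>"
    and eq: "\<And>x y. x \<in> X \<Longrightarrow> y \<in> X \<Longrightarrow> inverse \<kappa> * \<rho> x y \<le> d x y \<and> d x y \<le> \<kappa> * \<rho> x y"
    unfolding equivalent_quasi_metrics_def by blast
  have \<rho>_le: "\<rho> x y \<le> \<kappa> * d x y" if "x \<in> X" "y \<in> X" for x y
    using eq[OF that] \<kappa> by (simp add: field_simps)
  have \<rho>_sub: "qball X \<rho> x t \<subseteq> qball X d x (\<kappa> * t)" if "x \<in> X" for x t
  proof
    fix y assume y: "y \<in> qball X \<rho> x t"
    hence "\<kappa> * \<rho> x y < \<kappa> * t" using \<kappa> by (simp add: qball_def)
    with y eq[of x y] that show "y \<in> qball X d x (\<kappa> * t)" by (auto simp: qball_def)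
  qed
  have \<rho>_fin: "emeasure M (qball X \<rho> x t) < \<infinity>" if "x \<in> X" "0 < t" for x t
    using emeasure_mono[OF \<rho>_sub dball] dball_fin that \<kappa> 
    by (meson le_less_trans mult_pos_pos)
  have \<rho>_pos: "0 < emeasure M (qball X \<rho> x t)" if x: "x \<in> X" and t: "0 < t" for x t
  proof -
    have "qball X d x (t / \<kappa>) \<subseteq> qball X \<rho> x t"
    proof
      fix y assume y: "y \<in> qball X d x (t / \<kappa>)"
      hence "\<kappa> * d x y < t" using \<kappa> by (simp add: qball_def field_simps)
      with y \<rho>_le[of x y] x show "y \<in> qball X \<rho> x t" by (auto simp: qball_def)
    qed
    hence "emeasure M (qball X d x (t / \<kappa>)) \<le> emeasure M (qball X \<rho> x t)"
      using \<rho>ball[OF x t] by (rule emeasure_mono)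
    moreover have "0 < emeasure M (qball X d x (t / \<kappa>))" using dball_pos x t \<kappa> by simp
    ultimately show ?thesis by (rule less_le_trans[rotated])
  qed
  obtain c where c: "0 < c" "\<And>t x y z. x \<in> X \<Longrightarrow> y \<in> X \<Longrightarrow> z \<in> X \<Longrightarrow>
    \<rho> x y < t \<or> \<rho> y x < t \<Longrightarrow> \<rho> y z < t \<or> \<rho> z y < t \<Longrightarrow> \<rho> x z < c * t"
    using quasi_triangle[OF qm\<rho>] by metis
  obtain c' where c': "0 < c'" "\<And>t x y z. x \<in> X \<Longrightarrow> y \<in> X \<Longrightarrow> z \<in> X \<Longrightarrow>
    d x y < t \<or> d y x < t \<Longrightarrow> d y z < t \<or> d z y < t \<Longrightarrow> d x z < c' * t"
    using quasi_triangle[OF qm] by metis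
  \<comment> \<open>Enlarged balls of radius \<open>c * s\<close> have \<open>\<rho>\<close>-diameter at most \<open>c * (c * s)\<close> and so \<open>d\<close>-diameter below
     \<open>r\<close>; the summand \<open>1\<close> ensures that balls of radius \<open>s\<close> also lie in \<open>d\<close>-balls of radius \<open>r\<close>.\<close>
  define s where "s = r / (\<kappa> * (c * c + 1))"
  have cc: "0 < c * c + 1" using c(1) by (intro add_nonneg_pos) auto
  have s: "0 < s" using r \<kappa> cc by (simp add: s_def)
  have "\<kappa> * s * (c * c + 1) = r" using \<kappa> cc by (simp add: s_def)
  hence s_eq: "\<kappa> * (c * (c * s)) + \<kappa> * s = r" by (simp add: algebra_simps)
  have \<kappa>s: "\<kappa> * s \<le> r" "\<kappa> * (c * (c * s)) \<le> r"
    using s_eq c(1) \<kappa> s by (auto simp: add_increasing intro: order_trans[OF _ eq_refl[OF s_eq]])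
  define w where "w x = 1 / emeasure M (qball X \<rho> x s)" for x
  have wm[measurable]: "w \<in> borel_measurable M"
    unfolding w_def using \<rho>meas[OF s] by measurable
  have wmN[measurable]: "w \<in> borel_measurable N" using wm NM by (simp cong: measurable_cong_sets)
  have w_fin: "w x < \<infinity>" if "x \<in> X" for x
    using \<rho>_pos[OF that s] by (simp add: w_def ennreal_divide_eq_top_iff less_top[symmetric])
  obtain x0 where x0: "x0 \<in> X" using qm unfolding quasi_metric_on_def by blast
  define G where "G n = qball X d x0 (real (Suc n)) \<inter> {x \<in> X. w x \<le> ennreal (real (Suc n))}" for n
  have G: "G n \<in> sets M" for n
    unfolding G_def X_def[symmetric] using dball[OF x0, of "real (Suc n)"] unfolding X_def by measurable
  have AN[measurable]: "X - G n \<in> sets N" for n using G NM unfolding X_def by auto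
  have "(\<lambda>n. \<integral>\<^sup>+x\<in>X - G n. w x \<partial>N) \<longlonglongrightarrow> (\<integral>\<^sup>+x. 0 \<partial>N)"
  proof (rule nn_integral_dominated_convergence[where w = w])
    show "AE x in N. (\<lambda>n. w x * indicator (X - G n) x) \<longlonglongrightarrow> 0"
    proof (intro AE_I2)
      fix x assume "x \<in> space N"
      hence x: "x \<in> X" using sets_eq_imp_space_eq[OF NM] by (simp add: X_def)
      obtain n where n: "w x = ennreal n" "0 \<le> n"
        using w_fin[OF x] by (cases "w x") auto
      have "eventually (\<lambda>k. max n (d x0 x) < real k) sequentially"
        using filterlim_real_sequentially unfolding filterlim_at_top_dense by blast
      hence "eventually (\<lambda>k. w x * indicator (X - G k) x = 0) sequentially"
      proof eventually_elim
        case (elim k)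
        hence "x \<in> G k"
          using x n(1) by (auto simp: G_def qball_def simp del: ennreal_plus intro!: ennreal_leI)
        thus ?case by simp
      qed
      thus "(\<lambda>n. w x * indicator (X - G n) x) \<longlonglongrightarrow> 0"
        by (rule tendsto_eventually)
    qed
    show "(\<integral>\<^sup>+x. w x \<partial>N) < \<infinity>" using \<rho>int[OF s] by (simp add: w_def)
    show "(\<lambda>x. w x * indicator (X - G n) x) \<in> borel_measurable N" for n by measurable
  qed (auto simp: indicator_def)
  hence "eventually (\<lambda>n. (\<integral>\<^sup>+x\<in>X - G n. w x \<partial>N) < ennreal \<tau>) sequentially"
    using \<tau> by (intro order_tendstoD) auto
  then obtain n where n: "(\<integral>\<^sup>+x\<in>X - G n. w x \<partial>N) < ennreal \<tau>"
    by (auto simp: eventually_sequentially)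
  define R where "R = real (Suc n) + \<kappa> * s"
  have \<kappa>s0: "0 < \<kappa> * s" using \<kappa> s by simp
  hence R: "real (Suc n) \<le> R" "\<kappa> * s \<le> R" "0 < R" by (auto simp: R_def)
  have GX: "G n \<subseteq> X" by (auto simp: G_def)
  have "\<exists>F. finite F \<and> F \<subseteq> G n \<and> (\<forall>x\<in>G n. \<exists>z\<in>F. qball X \<rho> x s \<inter> qball X \<rho> z s \<noteq> {})"
  proof (rule finite_maximal_disjoint_family[where W = "qball X d x0 (c' * R)" and K = "real (Suc n)"])
    fix x assume xG: "x \<in> G n"
    hence x: "x \<in> X" using GX by blast
    show "qball X \<rho> x s \<in> sets M" using \<rho>ball x s by blast
    show "qball X \<rho> x s \<noteq> {}" using \<rho>_pos[OF x s] by auto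
    show "qball X \<rho> x s \<subseteq> qball X d x0 (c' * R)"
    proof
      fix y assume "y \<in> qball X \<rho> x s"
      hence y: "y \<in> X" "d x y < \<kappa> * s" using \<rho>_sub[OF x] by (auto simp: qball_def)
      have "d x0 x < real (Suc n)" using xG by (simp add: G_def qball_def)
      hence "d x0 y < c' * R" using y R by (intro c'(2)[OF x0 x]) auto
      with y show "y \<in> qball X d x0 (c' * R)" by (simp add: qball_def)
    qed
    have pos: "0 < emeasure M (qball X \<rho> x s)" "emeasure M (qball X \<rho> x s) < \<infinity>"
      using \<rho>_pos \<rho>_fin x s by auto
    have "1 = w x * emeasure M (qball X \<rho> x s)"
      using pos unfolding w_def
      by (subst mult.commute) (simp add: ennreal_times_divide ennreal_divide_self)
    also have "\<dots> \<le> ennreal (real (Suc n)) * emeasure M (qball X \<rho> x s)"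
      using xG by (intro mult_right_mono) (auto simp: G_def)
    finally show "1 \<le> ennreal (real (Suc n)) * emeasure M (qball X \<rho> x s)" .
  qed (use dball[OF x0] dball_fin[OF x0] c'(1) R in auto)
  then obtain F where F: "finite F" "F \<subseteq> G n"
    and touch: "\<And>x. x \<in> G n \<Longrightarrow> \<exists>z\<in>F. qball X \<rho> x s \<inter> qball X \<rho> z s \<noteq> {}" by blast
  have FX: "F \<subseteq> X" using F GX by blast
  have cs: "0 < c * s" using c s by simp
  \<comment> \<open>By maximality the ball of each point of \<open>G n\<close> meets the ball of some \<open>z\<close> in \<open>F\<close>.\<close>
  have cover: "X - (\<Union>z\<in>F. qball X \<rho> z (c * s)) \<subseteq> X - G n"
  proof safe
    fix x assume x: "x \<in> G n" and "x \<notin> (\<Union>z\<in>F. qball X \<rho> z (c * s))"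
    moreover obtain z y where "z \<in> F" "y \<in> X" "\<rho> x y < s" "\<rho> z y < s"
      using touch[OF x] by (auto simp: qball_def)
    moreover have "\<rho> z x < c * s"
      using calculation GX FX by (intro c(2)[of z y x]) auto
    ultimately show False using GX by (auto simp: qball_def)
  qed
  show ?thesis
  proof (rule small_pieces_up_to_tailI[OF F(1), where Q = "\<lambda>z. qball X \<rho> z (c * s)" and w = w])
    fix z x y assume z: "z \<in> F" and xy: "x \<in> qball X \<rho> z (c * s)" "y \<in> qball X \<rho> z (c * s)"
    hence X: "x \<in> X" "y \<in> X" "z \<in> X" using FX by (auto simp: qball_def)
    have "\<rho> x y < c * (c * s)"
      using xy X by (intro c(2)[of x z y]) (auto simp: qball_def)
    hence "\<kappa> * \<rho> x y < \<kappa> * (c * (c * s))" using \<kappa> by simp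
    thus "d x y < r" using eq[OF X(1,2)] \<kappa>s by linarith
  next
    fix x assume "x \<in> space M - (\<Union>z\<in>F. qball X \<rho> z (c * s))"
    hence x: "x \<in> X" by (simp add: X_def)
    have "qball X \<rho> x s \<subseteq> qball X d x r"
      using \<rho>_sub[OF x, of s] \<kappa>s(1) by (auto simp: qball_def)
    thus "\<exists>D\<in>sets M. D \<subseteq> qball (space M) d x r \<and> 0 < emeasure M D \<and> emeasure M D < \<infinity> \<and>
        1 / emeasure M D \<le> w x"
      using x s \<rho>ball \<rho>_pos \<rho>_fin unfolding X_def[symmetric] w_def
      by (intro bexI[of _ "qball X \<rho> x s"]) auto
  next
    have "(\<integral>\<^sup>+x\<in>space M - (\<Union>z\<in>F. qball X \<rho> z (c * s)). w x \<partial>N) \<le> (\<integral>\<^sup>+x\<in>X - G n. w x \<partial>N)"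
      unfolding X_def[symmetric] using cover
      by (intro nn_integral_mono mult_left_mono) (auto simp: indicator_def)
    with n show "(\<integral>\<^sup>+x\<in>space M - (\<Union>z\<in>F. qball X \<rho> z (c * s)). w x \<partial>N) \<le> ennreal \<tau>"
      by simp
  qed (use FX \<rho>ball \<rho>_fin cs in auto)
qed

section \<open>Compact embeddings\<close>

text \<open>
  The last two assumptions are what both scales of spaces have in common: a bound on the norm bounds the
  \<open>L\<^sup>p\<close>-norm of the function and, uniformly in the scale, those of the members of some gradient.
\<close>
lemma compact_embedding_Lp_if_small_pieces:
  assumes qm: "quasi_metric_on (space M) d" and \<alpha>: "0 < \<alpha>" and p: "0 < p" and C: "0 < C"
    and NM: "sets N = sets M" "\<forall>A\<in>sets M. emeasure N A \<le> ennreal C * emeasure M A"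
    and pieces: "\<And>r \<tau>. 0 < r \<Longrightarrow> 0 < \<tau> \<Longrightarrow> small_pieces_up_to_tail d M N r \<tau>"
    and S: "S \<subseteq> Lp_space p M"
    and norm: "\<And>u R. nrm u \<le> ennreal R \<Longrightarrow> Lp_norm p M u \<le> ennreal R"
    and gr: "\<And>u R. nrm u \<le> ennreal R \<Longrightarrow>
      \<exists>g\<in>fractional_gradients \<alpha> d M u. \<forall>k. Lp_norm p M (g k) \<le> ennreal (\<bar>R\<bar> + 1)"
  shows "compact_embedding_Lp M S nrm p N"
  unfolding compact_embedding_Lp_def
proof (intro conjI allI impI ballI subsetI)
  fix u assume "u \<in> S"
  hence u: "u \<in> borel_measurable M" "(\<integral>\<^sup>+x. ennreal (\<bar>u x\<bar> powr p) \<partial>M) < \<infinity>"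
    using S Lp_space_iff[OF p] by auto
  note [measurable] = u(1)
  have "(\<integral>\<^sup>+x. ennreal (\<bar>u x\<bar> powr p) \<partial>N) \<le> ennreal C * (\<integral>\<^sup>+x. ennreal (\<bar>u x\<bar> powr p) \<partial>M)"
    by (intro nn_integral_le_of_measure_le[OF NM]) measurable
  also have "\<dots> < \<infinity>" using u by (simp add: ennreal_mult_less_top)
  finally show "u \<in> Lp_space p N"
    using p u(1) NM(1) by (simp add: Lp_space_iff cong: measurable_cong_sets)
next
  fix u v assume "AE x in M. u x = v x"
  thus "AE x in N. u x = v x" by (rule AE_of_measure_le[OF NM])
next
  fix B assume B: "B \<subseteq> S" and "\<exists>R::real. \<forall>u\<in>B. nrm u \<le> ennreal R"
  then obtain R where R: "\<And>u. u \<in> B \<Longrightarrow> nrm u \<le> ennreal R" by blast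
  show "totally_bounded_in_Lp p N B"
  proof (rule totally_bounded_in_Lp_if_uniform_majorants[OF p NM C])
    show "0 \<le> \<bar>R\<bar> powr p" by simp
    fix u assume u: "u \<in> B"
    thus "u \<in> borel_measurable M" using B S by (auto simp: Lp_space_def)
    have "Lp_norm p M u \<le> ennreal \<bar>R\<bar>"
      using norm[OF R[OF u]] by (rule order_trans) (auto intro: ennreal_leI)
    thus "(\<integral>\<^sup>+x. ennreal (\<bar>u x\<bar> powr p) \<partial>M) \<le> ennreal (\<bar>R\<bar> powr p)"
      using p by (intro integral_powr_le_if_Lp_norm_le) auto
  next
    fix \<eta> :: real assume "0 < \<eta>"
    thus "\<exists>r>0. \<forall>u\<in>B. \<exists>h. oscillation_majorant p d M r u h \<and> (\<integral>\<^sup>+x. h x \<partial>M) \<le> ennreal \<eta>"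
      using gr[OF R] by (intro uniform_oscillation_majorants[OF qm \<alpha> p, of "\<bar>R\<bar> + 1"]) auto
  qed (use pieces in auto)
qed

theorem corollary6p5:
  fixes M N :: "'a measure" and d :: "'a \<Rightarrow> 'a \<Rightarrow> real" and C :: real
  assumes "quasi_metric_measure_space d M"
    and "sets N = sets M"
    and "0 < C" and "\<forall>A\<in>sets M. emeasure N A \<le> ennreal C * emeasure M A"
  shows
    "(measure_integrable_wrt d M N \<longrightarrow>
        (\<forall>(\<alpha>::real) (p::real) (q::ennreal). 0 < \<alpha> \<and> 0 < p \<and> 0 < q \<longrightarrow>
           compact_embedding_Lp M (HTL_space \<alpha> p q d M) (HTL_norm \<alpha> p q d M) p N \<and>
           compact_embedding_Lp M (HB_space \<alpha> p q d M) (HB_norm \<alpha> p q d M) p N)) \<and>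
     (totally_bounded_quasi_metric (space M) d \<longrightarrow>
        (\<forall>(\<alpha>::real) (p::real) (q::ennreal). 0 < \<alpha> \<and> 0 < p \<and> 0 < q \<longrightarrow>
           compact_embedding_Lp M (HTL_space \<alpha> p q d M) (HTL_norm \<alpha> p q d M) p N \<and>
           compact_embedding_Lp M (HB_space \<alpha> p q d M) (HB_norm \<alpha> p q d M) p N))"
proof -
  have qm: "quasi_metric_on (space M) d"
    using assms(1) by (simp add: quasi_metric_measure_space_def)
  have compact: "compact_embedding_Lp M (HTL_space \<alpha> p q d M) (HTL_norm \<alpha> p q d M) p N \<and>
      compact_embedding_Lp M (HB_space \<alpha> p q d M) (HB_norm \<alpha> p q d M) p N"
    if pieces: "\<And>r \<tau>. 0 < r \<Longrightarrow> 0 < \<tau> \<Longrightarrow> small_pieces_up_to_tail d M N r \<tau>"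
      and \<alpha>: "0 < \<alpha>" and p: "0 < p" and q: "0 < q" for \<alpha> p :: real and q :: ennreal
  proof
    show "compact_embedding_Lp M (HTL_space \<alpha> p q d M) (HTL_norm \<alpha> p q d M) p N"
    proof (rule compact_embedding_Lp_if_small_pieces[OF qm \<alpha> p assms(3,2,4) pieces])
      fix u R assume "HTL_norm \<alpha> p q d M u \<le> ennreal R"
      thus "Lp_norm p M u \<le> ennreal R"
        unfolding HTL_norm_def by (rule order_trans[rotated]) simp
    next
      fix u R assume "HTL_norm \<alpha> p q d M u \<le> ennreal R"
      thus "\<exists>g\<in>fractional_gradients \<alpha> d M u. \<forall>k. Lp_norm p M (g k) \<le> ennreal (\<bar>R\<bar> + 1)"
        by (rule Lp_norm_gradient_le_HTL[OF _ p q])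
    next
      show "HTL_space \<alpha> p q d M \<subseteq> Lp_space p M"
        unfolding HTL_space_def by (rule Collect_restrict)
    qed
    show "compact_embedding_Lp M (HB_space \<alpha> p q d M) (HB_norm \<alpha> p q d M) p N"
    proof (rule compact_embedding_Lp_if_small_pieces[OF qm \<alpha> p assms(3,2,4) pieces])
      fix u R assume "HB_norm \<alpha> p q d M u \<le> ennreal R"
      thus "Lp_norm p M u \<le> ennreal R"
        unfolding HB_norm_def by (rule order_trans[rotated]) simp
    next
      fix u R assume "HB_norm \<alpha> p q d M u \<le> ennreal R"
      thus "\<exists>g\<in>fractional_gradients \<alpha> d M u. \<forall>k. Lp_norm p M (g k) \<le> ennreal (\<bar>R\<bar> + 1)"
        by (rule Lp_norm_gradient_le_HB[OF _ q])
    next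
      show "HB_space \<alpha> p q d M \<subseteq> Lp_space p M"
        unfolding HB_space_def by (rule Collect_restrict)
    qed
  qed
  show ?thesis
  proof (intro conjI allI impI; elim conjE)
    fix \<alpha> p :: real and q :: ennreal
    assume pos: "0 < \<alpha>" "0 < p" "0 < q"
    show "compact_embedding_Lp M (HTL_space \<alpha> p q d M) (HTL_norm \<alpha> p q d M) p N"
      "compact_embedding_Lp M (HB_space \<alpha> p q d M) (HB_norm \<alpha> p q d M) p N"
      if "measure_integrable_wrt d M N"
      using compact[OF small_pieces_if_measure_integrable[OF assms(1) that assms(2)] pos] by auto
    show "compact_embedding_Lp M (HTL_space \<alpha> p q d M) (HTL_norm \<alpha> p q d M) p N"
      "compact_embedding_Lp M (HB_space \<alpha> p q d M) (HB_norm \<alpha> p q d M) p N"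
      if "totally_bounded_quasi_metric (space M) d"
      using compact[OF small_pieces_if_totally_bounded[OF assms(1) that] pos] by auto
  qed
qed

end
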